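(* Let $\mu=\mu_1\otimes\mu_2\otimes\cdots\otimes\mu_n$ be a product probability measure on a product space $\Omega=\Omega_1\otimes\Omega_2\otimes\cdots\otimes\Omega_n$ of Polish spaces. Let $\boldsymbol{f}:\Omega\to\mathbb{H}_d$ be a suitable function. Then, for $q=1$ and for every real $q\ge1.5$, $$\big[\mathbb{E}_\mu\operatorname{tr}|\boldsymbol{f}-\mathbb{E}_\mu\boldsymbol{f}|^{2q}\big]^{1/(2q)}\le\sqrt{2(2q-1)}\,\big[\mathbb{E}_\mu\operatorname{tr}\boldsymbol{V}(\boldsymbol{f})^q\big]^{1/(2q)},$$ where the matrix variance proxy is $$\boldsymbol{V}(\boldsymbol{f})(z):=\frac12\sum_{i=1}^n\mathbb{E}_Z\Big[\big(\boldsymbol{f}(z)-\boldsymbol{f}((z;Z)_i)\big)^2\Big]\quad\text{for }z\in\Omega.$$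
   Context: $\mathbb{H}_d$ is the space of $d\times d$ complex Hermitian matrices; $\operatorname{tr}$ is the trace; scalar functions are applied to Hermitian matrices via the eigenvalue decomposition, and nonlinear functions bind before trace and expectation. $\mathbb{E}_\mu$ is the entrywise expectation. $Z=(Z^1,\dots,Z^n)\sim\mu$ (superscripts are coordinate indices) and $(z;Z)_i=(z^1,\dots,z^{i-1},Z^i,z^{i+1},\dots,z^n)$. A suitable function here is a measurable function $\boldsymbol{f}:\Omega\to\mathbb{H}_d$ with $\mathbb{E}_\mu\|\boldsymbol{f}\|^2<\infty$, so that $\boldsymbol{V}(\boldsymbol{f})$ is defined $\mu$-almost everywhere (the right-hand side may be infinite). *)

theory Defs
  imports "HOL-Probability.Probability"
begin

definition polish_topology :: "'a topology \<Rightarrow> bool" where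
  "polish_topology T \<longleftrightarrow> completely_metrizable_space T \<and> separable_space T"

definition borel_of_topology :: "'a topology \<Rightarrow> 'a measure" where
  "borel_of_topology T = sigma (topspace T) {S. openin T S}"

definition conj_transpose :: "complex^'n^'m \<Rightarrow> complex^'m^'n" where
  "conj_transpose A = (\<chi> i j. cnj (A $ j $ i))"

definition hermitian :: "complex^'d^'d \<Rightarrow> bool" where
  "hermitian A \<longleftrightarrow> conj_transpose A = A"

definition unitary_matrix :: "complex^'d^'d \<Rightarrow> bool" where
  "unitary_matrix U \<longleftrightarrow> conj_transpose U ** U = mat 1 \<and> U ** conj_transpose U = mat 1"

definition real_diag :: "('d \<Rightarrow> real) \<Rightarrow> complex^'d^'d" where
  "real_diag l = (\<chi> i j. if i = j then complex_of_real (l i) else 0)"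

text \<open>A scalar function applied through an eigenvalue decomposition
  \<open>A = U diag(l) U*\<close>. The choice operator is harmless: by \<open>matrix_fun_eq\<close> below the value
  is the same for every decomposition of \<open>A\<close>. The value is unspecified when \<open>A\<close> has none,
  that is, when \<open>A\<close> is not Hermitian.\<close>

definition matrix_fun :: "(real \<Rightarrow> real) \<Rightarrow> complex^'d^'d \<Rightarrow> complex^'d^'d" where
  "matrix_fun \<phi> A =
    (SOME B. \<exists>U l. unitary_matrix U \<and>
       A = U ** real_diag l ** conj_transpose U \<and>
       B = U ** real_diag (\<lambda>i. \<phi> (l i)) ** conj_transpose U)"

lemma real_diag_mult_left: "(real_diag l ** W) $ i $ j = complex_of_real (l i) * W $ i $ j"
  by (simp add: real_diag_def matrix_matrix_mult_def if_distrib[of "\<lambda>x. x * _"] cong: if_cong)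

lemma real_diag_mult_right: "(W ** real_diag l) $ i $ j = W $ i $ j * complex_of_real (l j)"
  by (simp add: real_diag_def matrix_matrix_mult_def if_distrib[of "\<lambda>x. _ * x"] cong: if_cong)

lemma decomposition_fun_unique:
  assumes U: "unitary_matrix U" and V: "unitary_matrix V"
    and eq: "U ** real_diag l ** conj_transpose U = V ** real_diag m ** conj_transpose V"
  shows "U ** real_diag (\<lambda>i. \<phi> (l i)) ** conj_transpose U =
    V ** real_diag (\<lambda>i. \<phi> (m i)) ** conj_transpose V"
proof -
  define W where "W = conj_transpose V ** U"
  have U1: "conj_transpose U ** U = mat 1" and U2: "U ** conj_transpose U = mat 1"
    and V1: "conj_transpose V ** V = mat 1" and V2: "V ** conj_transpose V = mat 1"
    using U V by (auto simp: unitary_matrix_def)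
  have "W ** real_diag l = conj_transpose V ** U ** real_diag l ** (conj_transpose U ** U)"
    by (simp add: U1 W_def)
  also have "\<dots> = conj_transpose V ** (U ** real_diag l ** conj_transpose U) ** U"
    by (simp add: matrix_mul_assoc)
  also have "\<dots> = conj_transpose V ** V ** real_diag m ** W"
    by (simp add: eq W_def matrix_mul_assoc)
  also have "\<dots> = real_diag m ** W"
    by (simp add: V1)
  finally have "W ** real_diag l = real_diag m ** W" .
  then have "W $ i $ j * complex_of_real (l j) = complex_of_real (m i) * W $ i $ j" for i j
    by (metis real_diag_mult_left real_diag_mult_right)
  then have **: "W $ i $ j = 0 \<or> l j = m i" for i j
    by (auto simp: mult.commute)
  have "W $ i $ j * complex_of_real (\<phi> (l j)) = complex_of_real (\<phi> (m i)) * W $ i $ j" for i j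
    using **[of i j] by auto
  then have *: "W ** real_diag (\<lambda>i. \<phi> (l i)) = real_diag (\<lambda>i. \<phi> (m i)) ** W"
    by (simp add: vec_eq_iff real_diag_mult_left real_diag_mult_right)
  have "U ** real_diag (\<lambda>i. \<phi> (l i)) ** conj_transpose U =
      V ** conj_transpose V ** U ** real_diag (\<lambda>i. \<phi> (l i)) ** conj_transpose U"
    by (simp add: V2)
  also have "\<dots> = V ** (W ** real_diag (\<lambda>i. \<phi> (l i))) ** conj_transpose U"
    by (simp add: W_def matrix_mul_assoc)
  also have "\<dots> = V ** real_diag (\<lambda>i. \<phi> (m i)) ** conj_transpose V ** (U ** conj_transpose U)"
    unfolding * by (simp add: W_def matrix_mul_assoc)
  also have "\<dots> = V ** real_diag (\<lambda>i. \<phi> (m i)) ** conj_transpose V"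
    by (simp add: U2)
  finally show ?thesis .
qed

lemma matrix_fun_eq:
  assumes "unitary_matrix U"
  shows "matrix_fun \<phi> (U ** real_diag l ** conj_transpose U) =
    U ** real_diag (\<lambda>i. \<phi> (l i)) ** conj_transpose U"
  unfolding matrix_fun_def
proof (rule some_equality)
  show "\<exists>V m. unitary_matrix V \<and>
      U ** real_diag l ** conj_transpose U = V ** real_diag m ** conj_transpose V \<and>
      U ** real_diag (\<lambda>i. \<phi> (l i)) ** conj_transpose U =
      V ** real_diag (\<lambda>i. \<phi> (m i)) ** conj_transpose V"
    using assms by blast
qed (use decomposition_fun_unique[OF _ assms] in force)

definition spectral_norm :: "complex^'d^'d \<Rightarrow> real" where
  "spectral_norm A = onorm ((*v) A)"

definition matrix_expectation :: "'a measure \<Rightarrow> ('a \<Rightarrow> complex^'d^'d) \<Rightarrow> complex^'d^'d" where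
  "matrix_expectation M F = (\<chi> j k. \<integral>z. F z $ j $ k \<partial>M)"

definition suitable :: "'a measure \<Rightarrow> ('a \<Rightarrow> complex^'d^'d) \<Rightarrow> bool" where
  "suitable M F \<longleftrightarrow> F \<in> borel_measurable M \<and> (\<forall>z\<in>space M. hermitian (F z)) \<and>
    (\<integral>\<^sup>+z. ennreal ((spectral_norm (F z))\<^sup>2) \<partial>M) < \<infinity>"

text \<open>The update \<open>z(i := Z i)\<close> is the vector \<open>(z;Z)\<^sub>i\<close>. The square is a matrix product:
  the power operation on the type of vectors is componentwise.\<close>

definition variance_proxy ::
    "nat \<Rightarrow> (nat \<Rightarrow> 'a) measure \<Rightarrow> ((nat \<Rightarrow> 'a) \<Rightarrow> complex^'d^'d) \<Rightarrow> (nat \<Rightarrow> 'a) \<Rightarrow> complex^'d^'d" where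
  "variance_proxy n M F z = (1/2) *\<^sub>R (\<Sum>i=1..n.
     matrix_expectation M (\<lambda>Z. (F z - F (z(i := Z i))) ** (F z - F (z(i := Z i)))))"

text \<open>Expectation of the trace of a positive semidefinite random matrix; it may be infinite.\<close>

definition expected_trace :: "'a measure \<Rightarrow> ('a \<Rightarrow> complex^'d^'d) \<Rightarrow> ennreal" where
  "expected_trace M F = (\<integral>\<^sup>+z. ennreal (Re (trace (F z))) \<partial>M)"

text \<open>Only meant for exponents \<open>p > 0\<close>.\<close>

definition ennreal_powr :: "ennreal \<Rightarrow> real \<Rightarrow> ennreal" where
  "ennreal_powr x p = (if x = \<infinity> then \<infinity> else ennreal (enn2real x powr p))"

end

theory Submission
  imports Defs
begin

text \<open>
  Assume \<open>E f = 0\<close>, let \<open>Z\<close> be an independent copy of \<open>z\<close>,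
  and put \<open>\<phi> t = sgn t * \<bar>t\<bar> powr (2q-1)\<close>, so that \<open>E tr
  \<bar>f\<bar>^(2q) = E tr f \<phi>(f)\<close>. Write \<open>mix J\<close> for the point with the
  coordinates of \<open>Z\<close> in \<open>J\<close> and those of \<open>z\<close> elsewhere. As
  \<open>J\<close> grows from the empty set to the set of all coordinates, \<open>E tr f(mix J)
  \<phi>(f(z))\<close> passes from \<open>E tr f \<phi>(f)\<close> to \<open>E tr f(Z) \<phi>(f(z))
  = 0\<close>. Exchanging one coordinate \<open>i\<close> between \<open>z\<close> and
  \<open>Z\<close> preserves their joint law, and therefore one step of this path, from
  \<open>J\<close> to \<open>J'\<close> with the new coordinate \<open>i\<close>, costs \<open>(1/2)
  E tr (f(mix J) - f(mix J')) (\<phi>(f(z)) - \<phi>(f(mix {i})))\<close>.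

  A mean value inequality for traces (\<open>mean_value_trace_inequality\<close>) bounds the step by
  the two squares \<open>(f(z) - f(mix {i}))^2\<close> and \<open>(f(mix J) - f(mix J'))^2\<close>,
  weighted by \<open>\<psi>(f)\<close> with \<open>\<psi> = \<bar>\<phi>'\<bar>\<close>; a free
  parameter balances the squares. It needs \<open>\<psi>\<close> to be constant or convex, hence the
  restriction to \<open>q = 1\<close> or \<open>q \<ge> 3/2\<close>. A further exchange of
  coordinates turns the second square into the first, and moves the mixed coordinates into the
  weight (\<open>correlation_step\<close>). Averaging over the order in which coordinates are
  replaced, with the parameter chosen according to the number of coordinates left, sums the steps to
  a bound by the supremum over \<open>J\<close> of \<open>2 E tr V(f) \<psi>(f(mix J))\<close>
  (\<open>subset_averaging\<close>, where the factor comes from \<open>1/\<surd>1 + \<dots> +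
  1/\<surd>n \<le> 2\<surd>n\<close>).

  Since \<open>mix J\<close> has the law of \<open>z\<close>, Young's inequality for traces
  separates this into a moment of \<open>V(f)\<close> and a multiple less than one of the moment
  \<open>E tr \<bar>f\<bar>^(2q)\<close>, and the latter is absorbed on the left. The result is
  \<open>E tr \<bar>f\<bar>^(2q) \<le> (2(2q-1))^q E tr V(f)^q\<close>.

  The absorbed moment has to be finite, while \<open>f\<close> is only square integrable. The
  argument is therefore run with \<open>\<phi>\<close> and \<open>\<psi>\<close> composed with the
  truncation of the real line to \<open>[-T, T]\<close>; this truncation is 1-Lipschitz, so the mean
  value inequality survives, and everything is bounded (\<open>truncated_moment_bound\<close>).
  Fatou's lemma removes the truncation.
\<close>

section \<open>Hermitian matrices\<close>

notation conj_transpose ("_\<^sup>\<dagger>" [1000] 999)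

abbreviation diag_in :: "complex^'d^'d \<Rightarrow> ('d \<Rightarrow> real) \<Rightarrow> complex^'d^'d" where
  "diag_in U l \<equiv> U ** real_diag l ** U\<^sup>\<dagger>"

lemma conj_transpose_nth [simp]: "(A\<^sup>\<dagger>) $ i $ j = cnj (A $ j $ i)"
  by (simp add: conj_transpose_def)

lemma conj_transpose_conj_transpose [simp]: "(A\<^sup>\<dagger>)\<^sup>\<dagger> = A"
  by (simp add: vec_eq_iff)

lemma conj_transpose_mult: "(A ** B)\<^sup>\<dagger> = B\<^sup>\<dagger> ** A\<^sup>\<dagger>"
  by (simp add: vec_eq_iff matrix_matrix_mult_def mult.commute)

lemma conj_transpose_real_diag [simp]: "(real_diag l)\<^sup>\<dagger> = real_diag l"
  by (simp add: vec_eq_iff real_diag_def)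

lemma conj_transpose_diff: "(A - B)\<^sup>\<dagger> = A\<^sup>\<dagger> - B\<^sup>\<dagger>"
  by (simp add: vec_eq_iff)

lemma unitary_cancel [simp]:
  assumes "unitary_matrix U"
  shows "U\<^sup>\<dagger> ** U = mat 1" "U ** U\<^sup>\<dagger> = mat 1"
    "X ** U\<^sup>\<dagger> ** U = X" "X ** U ** U\<^sup>\<dagger> = X"
  using assms by (auto simp add: unitary_matrix_def matrix_mul_assoc[symmetric, of X])

lemma unitary_matrix_conj_transpose_mult:
  assumes "unitary_matrix U" "unitary_matrix V"
  shows "unitary_matrix (U\<^sup>\<dagger> ** V)"
  unfolding unitary_matrix_def[of "U\<^sup>\<dagger> ** V"] using assms
  by (auto simp add: conj_transpose_mult matrix_mul_assoc)

lemma hermitian_diff: "hermitian A \<Longrightarrow> hermitian B \<Longrightarrow> hermitian (A - B)"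
  by (simp add: hermitian_def conj_transpose_diff)

lemma hermitian_square: "hermitian A \<Longrightarrow> hermitian (A ** A)"
  by (simp add: hermitian_def conj_transpose_mult)

lemma hermitian_diag_in [simp]: "hermitian (diag_in U l)"
  by (simp add: hermitian_def conj_transpose_mult matrix_mul_assoc)

lemma matrix_diff_rdistrib: "(A - B) ** C = A ** C - B ** (C :: complex^'d^'d)"
  and matrix_diff_ldistrib: "C ** (A - B) = C ** A - C ** (B :: complex^'d^'d)"
  by (simp_all add: vec_eq_iff matrix_matrix_mult_def sum_subtractf ring_distribs)

lemma matrix_square_diff_commute: "(A - B) ** (A - B) = (B - A) ** (B - (A :: complex^'d^'d))"
  by (simp add: matrix_diff_ldistrib matrix_diff_rdistrib)

lemma bounded_bilinear_matrix_mult: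
  "bounded_bilinear ((**) :: complex^'d^'d \<Rightarrow> complex^'d^'d \<Rightarrow> complex^'d^'d)"
  unfolding bilinear_conv_bounded_bilinear[symmetric] bilinear_def
  by (auto intro!: linearI simp: vec_eq_iff matrix_matrix_mult_def ring_distribs sum.distrib scaleR_sum_right)

lemma trace_conj_transpose_mult:
  fixes A B :: "complex^'d^'d"
  shows "trace (A\<^sup>\<dagger> ** B) = (\<Sum>i\<in>UNIV. \<Sum>j\<in>UNIV. cnj (A $ i $ j) * B $ i $ j)"
  unfolding trace_def matrix_matrix_mult_def by (simp, rule sum.swap)

lemma Re_trace_mult_eq_inner:
  fixes A B :: "complex^'d^'d"
  assumes "hermitian A" shows "Re (trace (A ** B)) = A \<bullet> B"
  using trace_conj_transpose_mult[of A B] assms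
  by (simp add: hermitian_def inner_vec_def inner_complex_def)

text \<open>The inner product \<open>tr A* B\<close> may be computed in a pair of orthonormal bases. With
  eigenbases of two matrices \<open>A\<close> and \<open>B\<close> this turns every trace inequality
  below into an inequality between eigenvalues, weighted by the squared entries of \<open>U*
  V\<close>.\<close>

lemma trace_mult_unitary_invariant:
  fixes U V A B :: "complex^'d^'d"
  assumes "unitary_matrix U" "unitary_matrix V"
  shows "trace (A\<^sup>\<dagger> ** B) =
    (\<Sum>i\<in>UNIV. \<Sum>j\<in>UNIV. cnj ((U\<^sup>\<dagger> ** A ** V) $ i $ j) * (U\<^sup>\<dagger> ** B ** V) $ i $ j)"
proof -
  have "trace ((U\<^sup>\<dagger> ** A ** V)\<^sup>\<dagger> ** (U\<^sup>\<dagger> ** B ** V)) = trace (V\<^sup>\<dagger> ** (A\<^sup>\<dagger> ** B ** V))"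
    using assms(1) by (simp add: conj_transpose_mult matrix_mul_assoc)
  also have "\<dots> = trace (A\<^sup>\<dagger> ** B)"
    using assms(2) by (subst trace_mul_sym) simp
  finally show ?thesis
    by (simp only: trace_conj_transpose_mult[symmetric])
qed

lemma trace_square_diag_in:
  assumes "hermitian D" "unitary_matrix U" "unitary_matrix V"
  shows "trace (D ** D ** diag_in U p) =
    (\<Sum>i\<in>UNIV. \<Sum>j\<in>UNIV. complex_of_real (p i * (cmod ((U\<^sup>\<dagger> ** D ** V) $ i $ j))\<^sup>2))"
proof -
  have "trace (D ** D ** diag_in U p) = trace (D ** (D ** diag_in U p))"
    by (simp add: matrix_mul_assoc)
  also have "\<dots> = trace ((D ** diag_in U p) ** D)"
    by (rule trace_mul_sym)
  also have "\<dots> = trace ((diag_in U p ** D)\<^sup>\<dagger> ** D)"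
    using assms(1) by (simp add: hermitian_def conj_transpose_mult matrix_mul_assoc)
  also have "\<dots> = (\<Sum>i\<in>UNIV. \<Sum>j\<in>UNIV. cnj ((real_diag p ** (U\<^sup>\<dagger> ** D ** V)) $ i $ j) *
      (U\<^sup>\<dagger> ** D ** V) $ i $ j)"
    using assms(2,3) by (simp add: trace_mult_unitary_invariant[of U V] matrix_mul_assoc)
  also have "\<dots> = (\<Sum>i\<in>UNIV. \<Sum>j\<in>UNIV. complex_of_real (p i * (cmod ((U\<^sup>\<dagger> ** D ** V) $ i $ j))\<^sup>2))"
    by (intro sum.cong refl) (simp add: real_diag_mult_left mult.assoc complex_norm_square mult.commute del: of_real_power)
  finally show ?thesis .
qed

lemma trace_square_diag_in':
  assumes "hermitian D" "unitary_matrix U" "unitary_matrix V"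
  shows "trace (D ** D ** diag_in V r) =
    (\<Sum>i\<in>UNIV. \<Sum>j\<in>UNIV. complex_of_real (r j * (cmod ((U\<^sup>\<dagger> ** D ** V) $ i $ j))\<^sup>2))"
proof -
  have "U\<^sup>\<dagger> ** D ** V = (V\<^sup>\<dagger> ** D ** U)\<^sup>\<dagger>"
    using assms(1) by (simp add: hermitian_def conj_transpose_mult matrix_mul_assoc)
  then show ?thesis
    by (subst sum.swap) (simp add: trace_square_diag_in[OF assms(1,3,2)])
qed

lemma trace_diag_in_mult:
  assumes "unitary_matrix U" "unitary_matrix V"
  shows "trace (diag_in U p ** diag_in V r) =
    (\<Sum>i\<in>UNIV. \<Sum>j\<in>UNIV. complex_of_real (p i * r j * (cmod ((U\<^sup>\<dagger> ** V) $ i $ j))\<^sup>2))"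
proof -
  have "trace (diag_in U p ** diag_in V r) = trace ((diag_in U p)\<^sup>\<dagger> ** diag_in V r)"
    by (simp add: conj_transpose_mult matrix_mul_assoc)
  also have "\<dots> = (\<Sum>i\<in>UNIV. \<Sum>j\<in>UNIV. cnj ((real_diag p ** (U\<^sup>\<dagger> ** V)) $ i $ j) *
      ((U\<^sup>\<dagger> ** V) ** real_diag r) $ i $ j)"
    using assms by (subst trace_mult_unitary_invariant[of U V]) (simp_all add: matrix_mul_assoc)
  also have "\<dots> = (\<Sum>i\<in>UNIV. \<Sum>j\<in>UNIV. complex_of_real (p i * r j * (cmod ((U\<^sup>\<dagger> ** V) $ i $ j))\<^sup>2))"
    by (intro sum.cong refl)
      (simp add: real_diag_mult_left real_diag_mult_right complex_norm_square mult_ac del: of_real_power)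
  finally show ?thesis .
qed

lemma unitary_row_sum:
  assumes "unitary_matrix W" shows "(\<Sum>j\<in>UNIV. (cmod (W $ i $ j))\<^sup>2) = 1"
proof -
  have "complex_of_real (\<Sum>j\<in>UNIV. (cmod (W $ i $ j))\<^sup>2) = (W ** W\<^sup>\<dagger>) $ i $ i"
    by (simp add: matrix_matrix_mult_def complex_norm_square del: of_real_power)
  also have "\<dots> = 1" using assms by (simp add: mat_def)
  finally show ?thesis using of_real_eq_1_iff by blast
qed

lemma unitary_column_sum:
  assumes "unitary_matrix W" shows "(\<Sum>i\<in>UNIV. (cmod (W $ i $ j))\<^sup>2) = 1"
proof -
  have "unitary_matrix (W\<^sup>\<dagger>)" using assms unfolding unitary_matrix_def by simp
  from unitary_row_sum[OF this, of j] show ?thesis by simp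
qed

lemma trace_diag_in: "unitary_matrix U \<Longrightarrow> trace (diag_in U p) = (\<Sum>i\<in>UNIV. complex_of_real (p i))"
proof -
  assume "unitary_matrix U"
  then have "trace (diag_in U p) = trace (real_diag p)"
    by (subst trace_mul_sym) (simp add: matrix_mul_assoc)
  then show ?thesis by (simp add: trace_def real_diag_def)
qed

section \<open>The spectral theorem\<close>

definition cdot :: "complex^'d \<Rightarrow> complex^'d \<Rightarrow> complex" where
  "cdot x y = (\<Sum>i\<in>UNIV. cnj (x $ i) * y $ i)"

lemma inner_eq_Re_cdot: "x \<bullet> y = Re (cdot x y)"
  by (simp add: cdot_def inner_vec_def inner_complex_def)

lemma cdot_scale: "cdot x (c *s y) = c * cdot x y" "cdot (c *s x) y = cnj c * cdot x y"
  by (simp_all add: cdot_def sum_distrib_left mult_ac)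

lemma cdot_add: "cdot x (y + z) = cdot x y + cdot x z"
  by (simp add: cdot_def ring_distribs sum.distrib)

lemma cdot_commute: "cdot y x = cnj (cdot x y)"
  by (simp add: cdot_def mult.commute)

lemma cdot_self: "cdot x x = complex_of_real ((norm x)\<^sup>2)"
proof -
  have "Im (cdot x x) = 0"
    using cdot_commute[of x x] by (simp add: complex_eq_iff)
  then show ?thesis
    by (simp add: complex_eq_iff power2_norm_eq_inner inner_eq_Re_cdot)
qed

lemma cdot_hermitian:
  assumes "hermitian A" shows "cdot x (A *v y) = cdot (A *v x) y"
proof -
  have A: "cnj (A $ i $ j) = A $ j $ i" for i j
    using assms by (metis conj_transpose_nth hermitian_def)
  have "cdot x (A *v y) = (\<Sum>i\<in>UNIV. \<Sum>j\<in>UNIV. cnj (x $ i) * (A $ i $ j * y $ j))"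
    by (simp add: cdot_def matrix_vector_mult_def sum_distrib_left)
  also have "\<dots> = (\<Sum>j\<in>UNIV. \<Sum>i\<in>UNIV. cnj (x $ i) * (A $ i $ j * y $ j))"
    by (rule sum.swap)
  also have "\<dots> = cdot (A *v x) y"
    by (simp add: cdot_def matrix_vector_mult_def sum_distrib_left sum_distrib_right A mult_ac)
  finally show ?thesis .
qed

lemma scaleR_eq_scale: "r *\<^sub>R (x::complex^'d) = complex_of_real r *s x"
  by (simp add: vec_eq_iff) (simp add: scaleR_conv_of_real)

text \<open>The first-order condition at a maximum, without derivatives.\<close>

lemma linear_le_quadratic_imp_zero:
  fixes n c :: real
  assumes le: "\<And>t. 2 * t * n \<le> t\<^sup>2 * c" and "0 \<le> n"
  shows "n = 0"
proof (rule ccontr)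
  assume "n \<noteq> 0"
  with assms(2) have n: "n > 0" by simp
  define C where "C = \<bar>c\<bar> + 1"
  have C: "C > 0" "c < C" by (simp_all add: C_def add_nonneg_pos)
  have "2 * n\<^sup>2 * C = 2 * (n / C) * n * C\<^sup>2"
    using C by (simp add: power2_eq_square field_simps)
  also have "\<dots> \<le> ((n / C)\<^sup>2 * c) * C\<^sup>2"
    by (intro mult_right_mono le) simp
  also have "\<dots> = n\<^sup>2 * c"
    using C by (simp add: power2_eq_square field_simps)
  also have "\<dots> < n\<^sup>2 * C"
    using n C by simp
  finally show False using n C by simp
qed

text \<open>The quadratic form of \<open>A\<close>, restricted to the unit sphere of the orthogonal complement
  of eigenvectors found so far, attains its maximum by compactness. That complement is invariant
  under \<open>A\<close>, so the first-order condition at a maximum point \<open>x\<close> makes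
  \<open>A x\<close> a multiple of \<open>x\<close>.\<close>

lemma hermitian_eigenvector_orthogonal:
  fixes A :: "complex^'d^'d" and S :: "(complex^'d) set"
  assumes A: "hermitian A" and fin: "finite S" and card: "card S < CARD('d)"
    and eig: "\<And>v. v \<in> S \<Longrightarrow> \<exists>l::real. A *v v = complex_of_real l *s v"
  obtains x l where "norm x = 1" "\<And>v. v \<in> S \<Longrightarrow> cdot v x = 0" "A *v x = complex_of_real l *s x"
proof -
  define W where "W = {x. \<forall>v\<in>S. cdot v x = 0}"
  define g where "g x = x \<bullet> (A *v x)" for x
  have W_add: "x + r *\<^sub>R y \<in> W" and W_scale: "r *\<^sub>R x \<in> W" if "x \<in> W" "y \<in> W" for x y r
    using that by (simp_all add: W_def cdot_add cdot_scale scaleR_eq_scale)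
  (* Complex orthogonality to v is real orthogonality to both v and i v. *)
  let ?S = "S \<union> (*s) \<i> ` S"
  have "dim ?S \<le> card ?S"
    using fin by (intro dim_le_card') auto
  also have "\<dots> \<le> card S + card ((*s) \<i> ` S)"
    by (rule card_Un_le)
  also have "\<dots> \<le> 2 * card S"
    using card_image_le[OF fin] by simp
  also have "\<dots> < DIM(complex^'d)"
    using card by simp
  finally obtain x0 where x0: "x0 \<noteq> 0" "\<And>y. y \<in> span ?S \<Longrightarrow> orthogonal x0 y"
    using orthogonal_to_subspace_exists by blast
  have "x0 \<in> W" unfolding W_def
  proof safe
    fix v assume "v \<in> S"
    then have "orthogonal x0 v" "orthogonal x0 (\<i> *s v)"
      using x0(2) by (auto intro!: span_base)
    then show "cdot v x0 = 0"
      by (simp_all add: orthogonal_def inner_commute[of x0] inner_eq_Re_cdot cdot_scale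
          cdot_commute[of v x0] complex_eq_iff)
  qed
  then have "x0 /\<^sub>R norm x0 \<in> W \<inter> sphere 0 1"
    using x0(1) W_scale by simp
  then have ne: "W \<inter> sphere 0 1 \<noteq> {}" by blast
  have "closed W"
    unfolding W_def cdot_def Ball_def
    by (intro closed_Collect_all closed_Collect_imp open_Collect_const closed_Collect_eq continuous_intros)
  then have comp: "compact (W \<inter> sphere 0 1)"
    by (simp add: closed_Int_compact)
  have "continuous_on (W \<inter> sphere 0 1) g"
    unfolding g_def matrix_vector_mult_def by (intro continuous_intros)
  from continuous_attains_sup[OF comp ne this] obtain x where
    x: "x \<in> W" "norm x = 1" and max: "\<And>y. y \<in> W \<Longrightarrow> norm y = 1 \<Longrightarrow> g y \<le> g x"
    by auto
  have xx: "x \<bullet> x = 1" using x(2) by (simp add: dot_square_norm)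
  have A_add: "A *v (y + r *\<^sub>R z) = A *v y + r *\<^sub>R (A *v z)" for y z r
    by (simp add: matrix_vector_right_distrib scaleR_eq_scale matrix_vector_mult_scaleR vector_scalar_commute)
  have A_scale: "A *v (r *\<^sub>R z) = r *\<^sub>R (A *v z)" for z r
    by (simp add: scaleR_eq_scale vector_scalar_commute)
  have A_sym: "y \<bullet> (A *v z) = z \<bullet> (A *v y)" for y z
    by (metis A cdot_hermitian inner_commute inner_eq_Re_cdot)
  have bound: "g y \<le> g x * (y \<bullet> y)" if "y \<in> W" for y
  proof (cases "y = 0")
    case False
    have "g (y /\<^sub>R norm y) \<le> g x"
      using False that W_scale by (intro max) auto
    also have "g (y /\<^sub>R norm y) = g y / (norm y)\<^sup>2"
      by (simp add: g_def A_scale power2_eq_square divide_inverse)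
    finally show ?thesis
      using False by (simp add: divide_le_eq dot_square_norm)
  qed (simp add: g_def)
  define w where "w = A *v x - g x *\<^sub>R x"
  have "A *v x \<in> W"
    unfolding W_def
  proof safe
    fix v assume "v \<in> S"
    then obtain l :: real where "A *v v = complex_of_real l *s v" using eig by blast
    then show "cdot v (A *v x) = 0"
      using x(1) \<open>v \<in> S\<close> by (simp add: cdot_hermitian[OF A] cdot_scale W_def)
  qed
  then have w: "w \<in> W"
    using W_add[of "A *v x" x "- g x"] x(1) by (simp add: w_def)
  let ?c = "g x * (w \<bullet> w) - g w"
  (* Compare the value at x with the value at x + t w. *)
  have step: "2 * t * (w \<bullet> w) \<le> t\<^sup>2 * ?c" for t
  proof -
    have "g (x + t *\<^sub>R w) = g x + 2 * t * (w \<bullet> (A *v x)) + t\<^sup>2 * g w"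
      by (simp add: g_def A_add A_scale inner_simps A_sym[of x w] power2_eq_square algebra_simps)
    moreover have "(x + t *\<^sub>R w) \<bullet> (x + t *\<^sub>R w) = 1 + 2 * t * (w \<bullet> x) + t\<^sup>2 * (w \<bullet> w)"
      by (simp add: inner_simps xx inner_commute[of x w] power2_eq_square algebra_simps)
    ultimately have "g x + 2 * t * (w \<bullet> (A *v x)) + t\<^sup>2 * g w \<le>
        g x * (1 + 2 * t * (w \<bullet> x) + t\<^sup>2 * (w \<bullet> w))"
      using bound[OF W_add[OF x(1) w, of t]] by simp
    moreover have "2 * t * (w \<bullet> w) = 2 * t * (w \<bullet> (A *v x)) - g x * (2 * t * (w \<bullet> x))"
      by (subst (2) w_def) (simp add: inner_diff_right algebra_simps)
    ultimately show ?thesis by (simp add: algebra_simps)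
  qed
  have "w \<bullet> w = 0"
    using linear_le_quadratic_imp_zero[OF step] by simp
  then have "A *v x = complex_of_real (g x) *s x"
    by (simp add: w_def scaleR_eq_scale)
  with x show ?thesis
    by (intro that) (auto simp: W_def)
qed

lemma orthonormal_eigenvectors:
  fixes A :: "complex^'d^'d" and D :: "'d set"
  assumes A: "hermitian A"
  shows "\<exists>u l. (\<forall>i\<in>D. A *v u i = complex_of_real (l i) *s u i) \<and>
    (\<forall>i\<in>D. \<forall>j\<in>D. cdot (u i) (u j) = (if i = j then 1 else 0))"
  using finite[of D]
proof (induction D rule: finite_induct)
  case (insert k D)
  then obtain u l where eig: "\<And>i. i \<in> D \<Longrightarrow> A *v u i = complex_of_real (l i) *s u i"
    and orth: "\<And>i j. i \<in> D \<Longrightarrow> j \<in> D \<Longrightarrow> cdot (u i) (u j) = (if i = j then 1 else 0)"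
    by blast
  have "card (u ` D) \<le> card D" by (simp add: card_image_le)
  also have "\<dots> < CARD('d)" using insert.hyps by (intro psubset_card_mono) auto
  finally have card: "card (u ` D) < CARD('d)" .
  have "\<exists>m::real. A *v v = complex_of_real m *s v" if "v \<in> u ` D" for v
    using eig that by blast
  from hermitian_eigenvector_orthogonal[OF A _ card this] obtain x m where
    x: "norm x = 1" "\<And>v. v \<in> u ` D \<Longrightarrow> cdot v x = 0" "A *v x = complex_of_real m *s x"
    by auto
  have x': "cdot x (u i) = 0" if "i \<in> D" for i
    using x(2)[of "u i"] that by (simp add: cdot_commute[of x])
  show ?case
    using insert.hyps eig orth x x' cdot_self[of x]
    by (intro exI[of _ "u(k := x)"] exI[of _ "l(k := m)"]) (auto simp: x')
qed simp

lemma hermitian_diagonalization: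
  fixes A :: "complex^'d^'d"
  assumes "hermitian A"
  obtains U l where "unitary_matrix U" "A = diag_in U l"
proof -
  obtain u :: "'d \<Rightarrow> complex^'d" and l where eig: "\<And>i. A *v u i = complex_of_real (l i) *s u i"
    and orth: "\<And>i j. cdot (u i) (u j) = (if i = j then 1 else 0)"
    using orthonormal_eigenvectors[OF assms, of UNIV] by auto
  define U :: "complex^'d^'d" where "U = (\<chi> i j. u j $ i)"
  have U1: "U\<^sup>\<dagger> ** U = mat 1"
    using orth by (simp add: vec_eq_iff matrix_matrix_mult_def U_def mat_def cdot_def)
  then have U: "unitary_matrix U"
    unfolding unitary_matrix_def using matrix_left_right_inverse[of "U\<^sup>\<dagger>" U] by blast
  have "(A ** U) $ i $ j = (U ** real_diag l) $ i $ j" for i j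
    using arg_cong[OF eig[of j], of "\<lambda>v. v $ i"] unfolding real_diag_mult_right
    by (simp add: U_def matrix_matrix_mult_def matrix_vector_mult_def mult.commute)
  then have "A ** U = U ** real_diag l"
    by (simp add: vec_eq_iff)
  then have "A ** U ** U\<^sup>\<dagger> = diag_in U l" by simp
  then show ?thesis using U that by simp
qed

section \<open>Functions of a Hermitian matrix\<close>

lemma matrix_fun_cases:
  assumes "hermitian A"
  obtains U l where "unitary_matrix U" "A = diag_in U l" "\<And>\<phi>. matrix_fun \<phi> A = diag_in U (\<lambda>i. \<phi> (l i))"
  using hermitian_diagonalization[OF assms] matrix_fun_eq by metis

lemma hermitian_matrix_fun [simp]: "hermitian A \<Longrightarrow> hermitian (matrix_fun \<phi> A)"
  by (metis matrix_fun_cases hermitian_diag_in)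

lemma diag_in_nth: "diag_in U p $ i $ j = (\<Sum>k\<in>UNIV. complex_of_real (p k) * (U $ i $ k * cnj (U $ j $ k)))"
  by (simp add: matrix_matrix_mult_def[of "U ** real_diag p"] real_diag_mult_right mult_ac)

lemma diag_in_add: "diag_in U (\<lambda>i. p i + r i) = diag_in U p + diag_in U r"
  by (simp add: vec_eq_iff diag_in_nth ring_distribs sum.distrib del: of_real_add)
     (simp add: ring_distribs sum.distrib)

lemma diag_in_scaleR: "diag_in U (\<lambda>i. c * p i) = c *\<^sub>R diag_in U p"
  by (simp add: vec_eq_iff diag_in_nth) (simp add: scaleR_conv_of_real sum_distrib_left mult_ac)

lemma diag_in_mult:
  assumes "unitary_matrix U"
  shows "diag_in U p ** diag_in U r = diag_in U (\<lambda>i. p i * r i)"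
proof -
  have "real_diag p ** real_diag r = real_diag (\<lambda>i. p i * r i)"
    by (simp add: vec_eq_iff real_diag_mult_left) (simp add: real_diag_def)
  then have "diag_in U (\<lambda>i. p i * r i) = U ** real_diag p ** real_diag r ** U\<^sup>\<dagger>"
    by (simp flip: matrix_mul_assoc)
  then show ?thesis using assms by (simp add: matrix_mul_assoc)
qed

lemma diag_in_one: "unitary_matrix U \<Longrightarrow> diag_in U (\<lambda>_. 1) = mat 1"
proof -
  assume U: "unitary_matrix U"
  have "real_diag (\<lambda>_. 1) = (mat 1 :: complex^'a^'a)"
    by (simp add: vec_eq_iff real_diag_def mat_def)
  then show ?thesis using U by simp
qed

lemma
  assumes "hermitian A"
  shows matrix_fun_id: "matrix_fun (\<lambda>x. x) A = A"
    and matrix_fun_const: "matrix_fun (\<lambda>_. c) A = c *\<^sub>R mat 1"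
    and matrix_fun_add: "matrix_fun (\<lambda>x. \<phi> x + \<psi> x) A = matrix_fun \<phi> A + matrix_fun \<psi> A"
    and matrix_fun_scaleR: "matrix_fun (\<lambda>x. c * \<phi> x) A = c *\<^sub>R matrix_fun \<phi> A"
    and matrix_fun_mult: "matrix_fun (\<lambda>x. \<phi> x * \<psi> x) A = matrix_fun \<phi> A ** matrix_fun \<psi> A"
proof -
  obtain U l where "unitary_matrix U" "A = diag_in U l"
    and "\<And>\<phi>. matrix_fun \<phi> A = diag_in U (\<lambda>i. \<phi> (l i))"
    using matrix_fun_cases[OF assms] by blast
  then show "matrix_fun (\<lambda>x. x) A = A" "matrix_fun (\<lambda>_. c) A = c *\<^sub>R mat 1"
    "matrix_fun (\<lambda>x. \<phi> x + \<psi> x) A = matrix_fun \<phi> A + matrix_fun \<psi> A"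
    "matrix_fun (\<lambda>x. c * \<phi> x) A = c *\<^sub>R matrix_fun \<phi> A"
    "matrix_fun (\<lambda>x. \<phi> x * \<psi> x) A = matrix_fun \<phi> A ** matrix_fun \<psi> A"
    using diag_in_scaleR[of U c "\<lambda>_. 1"]
    by (simp_all only: diag_in_one diag_in_add diag_in_scaleR diag_in_mult mult_1_right)
qed

lemma norm_matrix_fun_le:
  fixes A :: "complex^'d^'d"
  assumes "hermitian A" "\<And>x. \<bar>\<phi> x\<bar> \<le> c"
  shows "norm (matrix_fun \<phi> A) \<le> sqrt (real CARD('d)) * c"
proof -
  have c: "0 \<le> c" using assms(2)[of 0] by simp
  obtain U l where U: "unitary_matrix U" "\<And>\<phi>. matrix_fun \<phi> A = diag_in U (\<lambda>i. \<phi> (l i))"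
    using matrix_fun_cases[OF assms(1)] by metis
  have "(norm (matrix_fun \<phi> A))\<^sup>2 = Re (trace (matrix_fun \<phi> A ** matrix_fun \<phi> A))"
    using assms(1) by (simp add: Re_trace_mult_eq_inner power2_norm_eq_inner)
  also have "\<dots> = (\<Sum>i\<in>UNIV. (\<phi> (l i))\<^sup>2)"
    unfolding U(2) diag_in_mult[OF U(1)] trace_diag_in[OF U(1)] by (simp add: power2_eq_square)
  also have "\<dots> \<le> (\<Sum>i\<in>(UNIV :: 'd set). c\<^sup>2)"
    using assms(2) c by (intro sum_mono) (metis abs_le_square_iff abs_of_nonneg)
  also have "\<dots> = (sqrt (real CARD('d)) * c)\<^sup>2"
    by (simp add: power_mult_distrib)
  finally show ?thesis
    by (rule power2_le_imp_le) (simp add: c)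
qed

lemma borel_measurable_matrix_mult [measurable (raw)]:
  fixes F G :: "'a \<Rightarrow> complex^'d^'d"
  assumes "F \<in> borel_measurable M" "G \<in> borel_measurable M"
  shows "(\<lambda>z. F z ** G z) \<in> borel_measurable M"
  by (rule borel_measurable_continuous_Pair[OF assms])
    (unfold matrix_matrix_mult_def, intro continuous_intros)

lemma borel_measurable_trace [measurable (raw)]:
  fixes F :: "'a \<Rightarrow> complex^'d^'d"
  assumes [measurable]: "F \<in> borel_measurable M"
  shows "(\<lambda>z. trace (F z)) \<in> borel_measurable M"
proof -
  have "trace \<in> borel_measurable (borel :: (complex^'d^'d) measure)"
    unfolding trace_def[abs_def] by (intro borel_measurable_continuous_onI continuous_intros)
  from measurable_compose[OF assms this] show ?thesis .
qed

lemma borel_measurable_matrix_entries: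
  fixes F :: "'a \<Rightarrow> complex^'d^'d"
  assumes [measurable]: "\<And>j k. (\<lambda>z. F z $ j $ k) \<in> borel_measurable M"
  shows "F \<in> borel_measurable M"
  unfolding borel_measurable_euclidean_space[of F]
proof
  fix b :: "complex^'d^'d" assume "b \<in> Basis"
  then obtain j k u where "b = axis j (axis k u)" by (auto simp: Basis_vec_def)
  then show "(\<lambda>z. F z \<bullet> b) \<in> borel_measurable M" by (simp add: inner_axis)
qed

lemma borel_measurable_matrix_fun_polynomial:
  fixes F :: "'a \<Rightarrow> complex^'c^'c"
  assumes "real_polynomial_function p"
    and F: "F \<in> borel_measurable M" and herm: "\<And>z. z \<in> space M \<Longrightarrow> hermitian (F z)"
  shows "(\<lambda>z. matrix_fun p (F z)) \<in> borel_measurable M"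
  using assms(1)
proof induction
  case (linear h)
  have "h x = h 1 * x" for x
    using linear_cmul[OF bounded_linear.linear[OF linear], of x 1] by (simp add: mult.commute)
  then have h: "matrix_fun h A = matrix_fun (\<lambda>x. h 1 * x) A" for A :: "complex^'c^'c"
    by (intro arg_cong[of _ _ "\<lambda>h. matrix_fun h A"]) blast
  have "(\<lambda>z. h 1 *\<^sub>R F z) \<in> borel_measurable M"
    using F by measurable
  moreover have "matrix_fun h (F z) = h 1 *\<^sub>R F z" if "z \<in> space M" for z
    unfolding h using matrix_fun_scaleR[OF herm[OF that], of "h 1" "\<lambda>x. x"] matrix_fun_id[OF herm[OF that]] by simp
  ultimately show ?case by (simp cong: measurable_cong)
next
  case (const c)
  have "(\<lambda>z. c *\<^sub>R mat 1) \<in> borel_measurable M" by simp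
  then show ?case by (simp cong: measurable_cong add: matrix_fun_const[OF herm])
next
  case (add p r)
  then have "(\<lambda>z. matrix_fun p (F z) + matrix_fun r (F z)) \<in> borel_measurable M" by measurable
  then show ?case by (simp cong: measurable_cong add: matrix_fun_add[OF herm])
next
  case (mult p r)
  then have "(\<lambda>z. matrix_fun p (F z) ** matrix_fun r (F z)) \<in> borel_measurable M" by measurable
  then show ?case by (simp cong: measurable_cong add: matrix_fun_mult[OF herm])
qed

text \<open>Polynomial functions of a matrix are sums of matrix products, hence measurable, and a continuous
  function is a pointwise limit of polynomials by Weierstrass approximation on growing intervals.\<close>

lemma borel_measurable_matrix_fun:
  fixes F :: "'a \<Rightarrow> complex^'d^'d"
  assumes \<phi>: "continuous_on UNIV \<phi>"
    and F: "F \<in> borel_measurable M" and herm: "\<And>z. z \<in> space M \<Longrightarrow> hermitian (F z)"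
  shows "(\<lambda>z. matrix_fun \<phi> (F z)) \<in> borel_measurable M"
proof -
  have "\<exists>p. real_polynomial_function p \<and> (\<forall>x\<in>{-real k..real k}. \<bar>\<phi> x - p x\<bar> < 1 / real (Suc k))" for k
  proof -
    have "compact {-real k..real k}" "continuous_on {-real k..real k} \<phi>" "0 < 1 / real (Suc k)"
      using continuous_on_subset[OF \<phi>] by auto
    from Stone_Weierstrass_real_polynomial_function[OF this] show ?thesis by metis
  qed
  then obtain p where poly: "\<And>k. real_polynomial_function (p k)"
    and close: "\<And>k x. x \<in> {-real k..real k} \<Longrightarrow> \<bar>\<phi> x - p k x\<bar> < 1 / real (Suc k)"
    by metis
  have lim: "(\<lambda>k. p k x) \<longlonglongrightarrow> \<phi> x" for x
  proof -
    obtain K where K: "\<bar>x\<bar> \<le> real K" using real_arch_simple by blast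
    have "\<forall>\<^sub>F k in sequentially. norm (p k x - \<phi> x) \<le> 1 / real (Suc k)"
      using eventually_ge_at_top[of K]
    proof eventually_elim
      case (elim k)
      then have "x \<in> {-real k..real k}" using K by auto
      from close[OF this] show ?case by simp
    qed
    then have "(\<lambda>k. p k x - \<phi> x) \<longlonglongrightarrow> 0"
      by (rule Lim_null_comparison) (rule LIMSEQ_Suc[OF lim_inverse_n', unfolded])
    then show ?thesis by (rule LIM_zero_cancel)
  qed
  show ?thesis
  proof (rule borel_measurable_LIMSEQ_metric)
    fix k show "(\<lambda>z. matrix_fun (p k) (F z)) \<in> borel_measurable M"
      by (rule borel_measurable_matrix_fun_polynomial[OF poly F herm])
  next
    fix z assume "z \<in> space M"
    then obtain U l where eq: "\<And>\<phi>. matrix_fun \<phi> (F z) = diag_in U (\<lambda>i. \<phi> (l i))"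
      using matrix_fun_cases herm by metis
    show "(\<lambda>k. matrix_fun (p k) (F z)) \<longlonglongrightarrow> matrix_fun \<phi> (F z)"
      unfolding eq
      by (intro vec_tendstoI, unfold diag_in_nth)
        (intro tendsto_sum tendsto_mult tendsto_of_real tendsto_const lim)
  qed
qed

section \<open>Trace inequalities\<close>

lemma trace_matrix_fun_mono:
  assumes "hermitian A" "\<And>x. \<phi> x \<le> \<psi> x"
  shows "Re (trace (matrix_fun \<phi> A)) \<le> Re (trace (matrix_fun \<psi> A))"
proof -
  obtain U l where U: "unitary_matrix U" "\<And>\<phi>. matrix_fun \<phi> A = diag_in U (\<lambda>i. \<phi> (l i))"
    using matrix_fun_cases[OF assms(1)] by metis
  show ?thesis
    unfolding U(2) trace_diag_in[OF U(1)] using assms(2) by (simp add: sum_mono)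
qed

lemma trace_matrix_fun_nonneg:
  assumes "hermitian A" "\<And>x. 0 \<le> \<phi> x"
  shows "0 \<le> Re (trace (matrix_fun \<phi> A))"
proof -
  obtain U l where U: "unitary_matrix U" "\<And>\<phi>. matrix_fun \<phi> A = diag_in U (\<lambda>i. \<phi> (l i))"
    using matrix_fun_cases[OF assms(1)] by metis
  show ?thesis
    unfolding U(2) trace_diag_in[OF U(1)] using assms(2) by (simp add: sum_nonneg)
qed

lemma trace_square_diag_in_nonneg:
  assumes "hermitian D" "unitary_matrix U" "\<And>i. 0 \<le> p i"
  shows "0 \<le> Re (trace (D ** D ** diag_in U p))"
  using assms by (simp add: trace_square_diag_in[OF assms(1,2,2)] sum_nonneg)

lemma square_inner_matrix_fun_nonneg:
  assumes "hermitian D" "hermitian A" "\<And>x. 0 \<le> \<psi> x"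
  shows "0 \<le> (D ** D) \<bullet> matrix_fun \<psi> A"
proof -
  obtain U l where U: "unitary_matrix U" "\<And>\<phi>. matrix_fun \<phi> A = diag_in U (\<lambda>i. \<phi> (l i))"
    using matrix_fun_cases[OF assms(2)] by metis
  show ?thesis
    using trace_square_diag_in_nonneg[OF assms(1) U(1), of "\<lambda>i. \<psi> (l i)"] assms(3)
    by (simp add: U(2) Re_trace_mult_eq_inner[OF hermitian_square[OF assms(1)]])
qed

text \<open>The squared entries of the unitary \<open>U* V\<close> form a doubly stochastic matrix, so a scalar
  inequality that splits a product into a sum passes to traces.\<close>

lemma trace_diag_in_mult_le:
  assumes U: "unitary_matrix U" and V: "unitary_matrix V"
    and le: "\<And>i j. h i * k j \<le> p i + r j"
  shows "Re (trace (diag_in U h ** diag_in V k)) \<le> (\<Sum>i\<in>UNIV. p i) + (\<Sum>j\<in>UNIV. r j)"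
proof -
  let ?w = "\<lambda>i j. (cmod ((U\<^sup>\<dagger> ** V) $ i $ j))\<^sup>2"
  have W: "unitary_matrix (U\<^sup>\<dagger> ** V)"
    using U V by (rule unitary_matrix_conj_transpose_mult)
  have "Re (trace (diag_in U h ** diag_in V k)) = (\<Sum>i\<in>UNIV. \<Sum>j\<in>UNIV. h i * k j * ?w i j)"
    by (simp add: trace_diag_in_mult[OF U V])
  also have "\<dots> \<le> (\<Sum>i\<in>UNIV. \<Sum>j\<in>UNIV. (p i + r j) * ?w i j)"
    by (intro sum_mono mult_right_mono le) simp
  also have "\<dots> = (\<Sum>i\<in>UNIV. \<Sum>j\<in>UNIV. p i * ?w i j) + (\<Sum>j\<in>UNIV. \<Sum>i\<in>UNIV. r j * ?w i j)"
    unfolding distrib_right sum.distrib using sum.swap[of "\<lambda>i j. r j * ?w i j"] by simp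
  also have "\<dots> = (\<Sum>i\<in>UNIV. p i) + (\<Sum>j\<in>UNIV. r j)"
    by (simp add: unitary_row_sum[OF W] unitary_column_sum[OF W] flip: sum_distrib_left)
  finally show ?thesis .
qed

text \<open>Positive semidefiniteness of \<open>A\<close> is used in the form that \<open>tr A (U diag(p)
  U*)\<close> is nonnegative for all nonnegative \<open>p\<close>: being linear in \<open>A\<close>,
  this passes directly to expectations.\<close>

lemma psd_diag_in_nonneg:
  assumes U: "unitary_matrix U"
    and psd: "\<And>p. (\<And>i. 0 \<le> p i) \<Longrightarrow> 0 \<le> Re (trace (diag_in U l ** diag_in U p))"
  shows "0 \<le> l i"
proof -
  have "0 \<le> Re (trace (diag_in U l ** diag_in U (\<lambda>j. if j = i then 1 else 0)))"
    by (rule psd) simp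
  also have "\<dots> = l i"
    by (simp only: diag_in_mult[OF U] trace_diag_in[OF U])
      (simp add: if_distrib[of "\<lambda>y. _ * y"] cong: if_cong)
  finally show ?thesis .
qed

lemma matrix_fun_cong_psd:
  assumes herm: "hermitian A"
    and psd: "\<And>U p. unitary_matrix U \<Longrightarrow> (\<And>i. 0 \<le> p i) \<Longrightarrow> 0 \<le> Re (trace (A ** diag_in U p))"
    and eq: "\<And>x. 0 \<le> x \<Longrightarrow> \<phi> x = \<psi> x"
  shows "matrix_fun \<phi> A = matrix_fun \<psi> A"
proof -
  obtain U l where U: "unitary_matrix U" and A: "A = diag_in U l"
    and fA: "\<And>\<phi>. matrix_fun \<phi> A = diag_in U (\<lambda>i. \<phi> (l i))"
    using matrix_fun_cases[OF herm] by metis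
  have "0 \<le> l i" for i
    by (rule psd_diag_in_nonneg[OF U psd[OF U, unfolded A]])
  then show ?thesis unfolding fA by (simp add: eq)
qed

lemma trace_psd_matrix_fun_mult_le:
  assumes "hermitian A" "hermitian B"
    and psd: "\<And>U p. unitary_matrix U \<Longrightarrow> (\<And>i. 0 \<le> p i) \<Longrightarrow> 0 \<le> Re (trace (A ** diag_in U p))"
    and le: "\<And>x y. 0 \<le> x \<Longrightarrow> x * k y \<le> p x + r y"
  shows "Re (trace (A ** matrix_fun k B)) \<le>
    Re (trace (matrix_fun p A)) + Re (trace (matrix_fun r B))"
proof -
  obtain U l where U: "unitary_matrix U" and A: "A = diag_in U l"
    and fA: "\<And>\<phi>. matrix_fun \<phi> A = diag_in U (\<lambda>i. \<phi> (l i))"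
    using matrix_fun_cases[OF assms(1)] by metis
  obtain V m where V: "unitary_matrix V" "\<And>\<phi>. matrix_fun \<phi> B = diag_in V (\<lambda>i. \<phi> (m i))"
    using matrix_fun_cases[OF assms(2)] by metis
  have "0 \<le> l i" for i
    by (rule psd_diag_in_nonneg[OF U psd[OF U, unfolded A]])
  then show ?thesis
    unfolding fA V(2) trace_diag_in[OF U(1)] trace_diag_in[OF V(1)] unfolding A
    by simp (rule trace_diag_in_mult_le[OF U V(1) le])
qed

text \<open>With respect to an eigenbasis of \<open>A\<close> on the left and one of \<open>B\<close> on the
  right, the entries of \<open>\<phi>(A) - \<phi>(B)\<close> are those of \<open>A - B\<close>
  multiplied by difference quotients of \<open>\<phi>\<close> at pairs of eigenvalues. The bound on
  difference quotients and the inequality of arithmetic and geometric means apply entry by entry.\<close>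

lemma mean_value_trace_inequality:
  assumes A: "hermitian A" and B: "hermitian B" and C: "hermitian C" and s: "s > 0"
    and \<psi>: "\<And>x. 0 \<le> \<psi> x"
    and le: "\<And>x y. \<bar>\<phi> x - \<phi> y\<bar> \<le> \<bar>x - y\<bar> * (\<psi> x + \<psi> y) / 2"
  shows "Re (trace (C ** (matrix_fun \<phi> A - matrix_fun \<phi> B))) \<le>
    (s * (Re (trace ((A - B) ** (A - B) ** matrix_fun \<psi> A)) + Re (trace ((A - B) ** (A - B) ** matrix_fun \<psi> B)))
     + (Re (trace (C ** C ** matrix_fun \<psi> A)) + Re (trace (C ** C ** matrix_fun \<psi> B))) / s) / 4"
proof -
  obtain U a where U: "unitary_matrix U" and A': "A = diag_in U a"
    and fA: "\<And>\<phi>. matrix_fun \<phi> A = diag_in U (\<lambda>i. \<phi> (a i))"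
    using matrix_fun_cases[OF A] by metis
  obtain V b where V: "unitary_matrix V" and B': "B = diag_in V b"
    and fB: "\<And>\<phi>. matrix_fun \<phi> B = diag_in V (\<lambda>i. \<phi> (b i))"
    using matrix_fun_cases[OF B] by metis
  let ?W = "U\<^sup>\<dagger> ** V" and ?E = "U\<^sup>\<dagger> ** C ** V" and ?D = "U\<^sup>\<dagger> ** (A - B) ** V"
  have diff: "U\<^sup>\<dagger> ** (diag_in U p - diag_in V r) ** V = real_diag p ** ?W - ?W ** real_diag r" for p r
    using U V by (simp add: matrix_diff_ldistrib matrix_diff_rdistrib matrix_mul_assoc)
  have D: "?D $ i $ j = complex_of_real (a i - b j) * ?W $ i $ j" for i j
    unfolding A' B' diff by (simp add: real_diag_mult_left real_diag_mult_right ring_distribs)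
  have entry: "Re (cnj (?E $ i $ j) * (complex_of_real (\<phi> (a i) - \<phi> (b j)) * ?W $ i $ j)) \<le>
     (\<psi> (a i) + \<psi> (b j)) * (s * (cmod (?D $ i $ j))\<^sup>2 + (cmod (?E $ i $ j))\<^sup>2 / s) / 4" for i j
  proof -
    let ?e = "cmod (?E $ i $ j)" and ?d = "cmod (?D $ i $ j)"
    have "Re (cnj (?E $ i $ j) * (complex_of_real (\<phi> (a i) - \<phi> (b j)) * ?W $ i $ j))
        \<le> ?e * (\<bar>\<phi> (a i) - \<phi> (b j)\<bar> * cmod (?W $ i $ j))"
      by (rule order_trans[OF complex_Re_le_cmod]) (simp add: norm_mult del: of_real_diff)
    also have "\<dots> \<le> ?e * (\<bar>a i - b j\<bar> * (\<psi> (a i) + \<psi> (b j)) / 2 * cmod (?W $ i $ j))"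
      by (intro mult_left_mono mult_right_mono le) auto
    also have "\<dots> = (\<psi> (a i) + \<psi> (b j)) / 2 * (?d * ?e)"
      unfolding D norm_mult norm_of_real by simp
    also have "\<dots> \<le> (\<psi> (a i) + \<psi> (b j)) / 2 * ((s * ?d\<^sup>2 + ?e\<^sup>2 / s) / 2)"
    proof (intro mult_left_mono)
      have "0 \<le> (s * ?d - ?e)\<^sup>2 / s" using s by simp
      also have "\<dots> = s * ?d\<^sup>2 + ?e\<^sup>2 / s - 2 * (?d * ?e)"
        using s by (simp add: power2_eq_square field_simps)
      finally show "?d * ?e \<le> (s * ?d\<^sup>2 + ?e\<^sup>2 / s) / 2" by simp
    qed (use \<psi> in \<open>simp add: add_nonneg_nonneg\<close>)
    finally show ?thesis by simp
  qed
  have "Re (trace (C ** (matrix_fun \<phi> A - matrix_fun \<phi> B))) =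
      Re (trace (C\<^sup>\<dagger> ** (diag_in U (\<lambda>i. \<phi> (a i)) - diag_in V (\<lambda>i. \<phi> (b i)))))"
    using C unfolding fA fB by (simp add: hermitian_def)
  also have "\<dots> = (\<Sum>i\<in>UNIV. \<Sum>j\<in>UNIV. Re (cnj (?E $ i $ j) * (complex_of_real (\<phi> (a i) - \<phi> (b j)) * ?W $ i $ j)))"
    unfolding trace_mult_unitary_invariant[OF U V] diff Re_sum
    by (simp add: real_diag_mult_left real_diag_mult_right ring_distribs mult_ac)
  also have "\<dots> \<le> (\<Sum>i\<in>UNIV. \<Sum>j\<in>UNIV.
      (\<psi> (a i) + \<psi> (b j)) * (s * (cmod (?D $ i $ j))\<^sup>2 + (cmod (?E $ i $ j))\<^sup>2 / s) / 4)"
    by (intro sum_mono entry)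
  also have "\<dots> = (s * (Re (trace ((A - B) ** (A - B) ** matrix_fun \<psi> A)) + Re (trace ((A - B) ** (A - B) ** matrix_fun \<psi> B)))
     + (Re (trace (C ** C ** matrix_fun \<psi> A)) + Re (trace (C ** C ** matrix_fun \<psi> B))) / s) / 4"
    unfolding fA fB trace_square_diag_in[OF hermitian_diff[OF A B] U V] trace_square_diag_in[OF C U V]
      trace_square_diag_in'[OF hermitian_diff[OF A B] U V] trace_square_diag_in'[OF C U V]
    by (simp add: sum.distrib sum_distrib_left sum_divide_distrib ring_distribs add_divide_distrib mult_ac)
  finally show ?thesis .
qed

section \<open>Exchanging coordinates between two independent copies\<close>

definition swap :: "'i set \<Rightarrow> ('i \<Rightarrow> 'a) \<times> ('i \<Rightarrow> 'a) \<Rightarrow> ('i \<Rightarrow> 'a) \<times> ('i \<Rightarrow> 'a)" where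
  "swap J w = (override_on (fst w) (snd w) J, override_on (snd w) (fst w) J)"

lemma measurable_override_on:
  assumes [measurable]: "u \<in> measurable N (PiM I M)" "v \<in> measurable N (PiM I M)"
  shows "(\<lambda>w. override_on (u w) (v w) J) \<in> measurable N (PiM I M)"
proof -
  have "override_on (u w) (v w) J = (\<lambda>i\<in>I. if i \<in> J then v w i else u w i)" if "w \<in> space N" for w
    using measurable_space[OF assms(1) that] measurable_space[OF assms(2) that]
    by (auto simp: space_PiM override_on_def fun_eq_iff PiE_def extensional_def)
  moreover have "(\<lambda>w. \<lambda>i\<in>I. if i \<in> J then v w i else u w i) \<in> measurable N (PiM I M)"
    by (intro measurable_restrict) auto
  ultimately show ?thesis by (simp cong: measurable_cong)
qed

lemma measurable_swap [measurable]:
  "swap J \<in> measurable (PiM I M \<Otimes>\<^sub>M PiM I M) (PiM I M \<Otimes>\<^sub>M PiM I M)"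
  unfolding swap_def[abs_def] by (intro measurable_Pair measurable_override_on) auto

text \<open>Two copies of a family indexed by \<open>I\<close> form one family indexed by \<open>bool \<times>
  I\<close>. There the exchange is a permutation of indices that preserves the factor at each index,
  hence the product measure.\<close>

lemma distr_swap:
  fixes I :: "'i set" and M :: "'i \<Rightarrow> 'a measure"
  assumes fin: "finite I" and prob: "\<And>i. prob_space (M i)"
  shows "distr (PiM I M \<Otimes>\<^sub>M PiM I M) (PiM I M \<Otimes>\<^sub>M PiM I M) (swap J) = PiM I M \<Otimes>\<^sub>M PiM I M"
proof -
  let ?P = "PiM I M" and ?K = "(UNIV :: bool set) \<times> I"
  let ?N = "PiM ?K (\<lambda>k. M (snd k))"
  interpret M: product_sigma_finite M
    using prob by (simp add: product_sigma_finite_def prob_space_imp_sigma_finite)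
  interpret N: product_sigma_finite "\<lambda>k. M (snd k)"
    using prob by (simp add: product_sigma_finite_def prob_space_imp_sigma_finite)
  interpret P: prob_space ?P using prob by (intro prob_space_PiM)
  define join :: "('i \<Rightarrow> 'a) \<times> ('i \<Rightarrow> 'a) \<Rightarrow> bool \<times> 'i \<Rightarrow> 'a" where
    "join w = (\<lambda>k\<in>?K. if fst k then snd w (snd k) else fst w (snd k))" for w
  define split :: "(bool \<times> 'i \<Rightarrow> 'a) \<Rightarrow> ('i \<Rightarrow> 'a) \<times> ('i \<Rightarrow> 'a)" where
    "split x = (\<lambda>i\<in>I. x (False, i), \<lambda>i\<in>I. x (True, i))" for x
  define flip where "flip k = (if snd k \<in> J then (\<not> fst k, snd k) else k)" for k :: "bool \<times> 'i"
  define perm :: "(bool \<times> 'i \<Rightarrow> 'a) \<Rightarrow> bool \<times> 'i \<Rightarrow> 'a" where "perm x = (\<lambda>k\<in>?K. x (flip k))" for x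
  have snd_flip [simp]: "snd (flip k) = snd k" for k by (simp add: flip_def)
  have [measurable]: "join \<in> measurable (?P \<Otimes>\<^sub>M ?P) ?N"
    unfolding join_def[abs_def]
  proof (intro measurable_restrict)
    fix k assume "k \<in> ?K"
    then have [measurable]: "snd k \<in> I" by auto
    show "(\<lambda>w. if fst k then snd w (snd k) else fst w (snd k)) \<in> measurable (?P \<Otimes>\<^sub>M ?P) (M (snd k))"
      by (cases "fst k"; simp only: if_True if_False; measurable)
  qed
  have [measurable]: "split \<in> measurable ?N (?P \<Otimes>\<^sub>M ?P)"
    unfolding split_def[abs_def] by (intro measurable_Pair measurable_restrict)
      (auto intro!: measurable_component_singleton[where M="\<lambda>k. M (snd k)" and i="(_, _)", simplified])
  have reindex: "distr ?N ?N perm = ?N"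
  proof -
    have "inj_on flip ?K" "flip \<in> ?K \<rightarrow> ?K"
      by (auto simp: inj_on_def flip_def split: if_splits)
    from distr_PiM_reindex[of ?K "\<lambda>k. M (snd k)", OF prob this] show ?thesis
      by (simp add: perm_def[abs_def])
  qed
  have [measurable]: "perm \<in> measurable ?N ?N"
    unfolding perm_def[abs_def]
  proof (intro measurable_restrict)
    fix k assume "k \<in> ?K"
    then have "flip k \<in> ?K" by (auto simp: flip_def)
    then show "(\<lambda>x. x (flip k)) \<in> measurable ?N (M (snd k))"
      using measurable_component_singleton[of "flip k" ?K "\<lambda>k. M (snd k)"] by simp
  qed
  have join: "distr (?P \<Otimes>\<^sub>M ?P) ?N join = ?N"
  proof (rule N.PiM_eqI)
    show "finite ?K" using fin by simp
  next
    fix A assume A: "\<And>k. k \<in> ?K \<Longrightarrow> A k \<in> sets (M (snd k))"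
    let ?A = "\<lambda>b. Pi\<^sub>E I (\<lambda>i. A (b, i))"
    have sets: "?A b \<in> sets ?P" for b
      using fin A by (intro sets_PiM_I_finite) auto
    have "emeasure (distr (?P \<Otimes>\<^sub>M ?P) ?N join) (Pi\<^sub>E ?K A) =
        emeasure (?P \<Otimes>\<^sub>M ?P) (join -` Pi\<^sub>E ?K A \<inter> space (?P \<Otimes>\<^sub>M ?P))"
      using fin A by (intro emeasure_distr sets_PiM_I_finite) auto
    also have "join -` Pi\<^sub>E ?K A \<inter> space (?P \<Otimes>\<^sub>M ?P) = ?A False \<times> ?A True"
    proof -
      have "A (b, i) \<subseteq> space (M i)" if "i \<in> I" for b i
        using A[of "(b, i)"] that by (auto dest: sets.sets_into_space)
      moreover have "join w \<in> Pi\<^sub>E ?K A \<longleftrightarrow> (\<forall>b. \<forall>i\<in>I. (if b then snd w i else fst w i) \<in> A (b, i))" for w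
      proof -
        have "(\<forall>k\<in>?K. Q k) \<longleftrightarrow> (\<forall>b. \<forall>i\<in>I. Q (b, i))" for Q by auto
        then show ?thesis by (simp only: join_def restrict_PiE_iff fst_conv snd_conv)
      qed
      ultimately show ?thesis
        unfolding space_pair_measure space_PiM vimage_def all_bool_eq
        by (simp add: set_eq_iff PiE_iff subset_iff) blast
    qed
    also have "emeasure (?P \<Otimes>\<^sub>M ?P) (?A False \<times> ?A True) = emeasure ?P (?A False) * emeasure ?P (?A True)"
      by (intro P.emeasure_pair_measure_Times sets)
    also have "\<dots> = (\<Prod>i\<in>I. emeasure (M i) (A (False, i))) * (\<Prod>i\<in>I. emeasure (M i) (A (True, i)))"
      using fin A[of "(_, _)"] by (simp add: M.emeasure_PiM)
    also have "\<dots> = (\<Prod>b\<in>UNIV. \<Prod>i\<in>I. emeasure (M i) (A (b, i)))"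
      by (simp add: UNIV_bool)
    also have "\<dots> = (\<Prod>k\<in>?K. emeasure (M (snd k)) (A k))"
      by (subst prod.cartesian_product) (auto intro!: prod.cong)
    finally show "emeasure (distr (?P \<Otimes>\<^sub>M ?P) ?N join) (Pi\<^sub>E ?K A) = (\<Prod>k\<in>?K. emeasure (M (snd k)) (A k))" .
  qed simp
  have swap_eq: "split (perm (join w)) = swap J w" and split_join: "split (join w) = w"
    if "w \<in> space (?P \<Otimes>\<^sub>M ?P)" for w
    using that by (cases w; auto simp: split_def perm_def join_def flip_def swap_def override_on_def
        space_pair_measure space_PiM PiE_def extensional_def fun_eq_iff)+
  have "distr (?P \<Otimes>\<^sub>M ?P) (?P \<Otimes>\<^sub>M ?P) (swap J) = distr (?P \<Otimes>\<^sub>M ?P) (?P \<Otimes>\<^sub>M ?P) (\<lambda>w. split (perm (join w)))"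
    by (intro distr_cong refl) (simp add: swap_eq)
  also have "\<dots> = distr (distr (distr (?P \<Otimes>\<^sub>M ?P) ?N join) ?N perm) (?P \<Otimes>\<^sub>M ?P) split"
    by (simp add: distr_distr comp_def)
  also have "\<dots> = distr (distr (?P \<Otimes>\<^sub>M ?P) ?N join) (?P \<Otimes>\<^sub>M ?P) split"
    by (simp only: join reindex)
  also have "\<dots> = distr (?P \<Otimes>\<^sub>M ?P) (?P \<Otimes>\<^sub>M ?P) (\<lambda>w. w)"
    by (subst distr_distr) (auto intro!: distr_cong simp: split_join comp_def simp del: distr_id)
  finally show ?thesis by (simp add: distr_id)
qed

definition mix :: "'i set \<Rightarrow> ('i \<Rightarrow> 'a) \<times> ('i \<Rightarrow> 'a) \<Rightarrow> 'i \<Rightarrow> 'a" where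
  "mix J w = override_on (fst w) (snd w) J"

lemma mix_eq_fst_swap: "mix J w = fst (swap J w)"
  by (simp add: mix_def swap_def)

text \<open>All exchange arguments rest on this rule: exchanging the coordinates in \<open>K\<close> acts on the
  index sets of mixed points by symmetric difference.\<close>

lemma mix_swap: "mix J (swap K w) = mix (sym_diff J K) w"
  by (auto simp: mix_def swap_def override_on_def fun_eq_iff)

lemma mix_empty: "mix {} w = fst w" and mix_UNIV: "mix UNIV w = snd w"
  by (simp_all add: mix_def override_on_def)

section \<open>Matrix functions on a product space\<close>

lemma matrix_expectation_eq_integral:
  fixes F :: "'a \<Rightarrow> complex^'d^'d"
  assumes "integrable M F"
  shows "matrix_expectation M F = (\<integral>z. F z \<partial>M)"
proof -
  have "(\<integral>z. F z $ j $ k \<partial>M) = (\<integral>z. F z \<partial>M) $ j $ k" for j k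
    using integral_bounded_linear[OF bounded_linear_compose[OF bounded_linear_vec_nth[of k] bounded_linear_vec_nth[of j]] assms]
    by simp
  then show ?thesis by (simp add: matrix_expectation_def vec_eq_iff)
qed

lemma norm_le_spectral_norm:
  fixes A :: "complex^'d^'d"
  shows "norm A \<le> real (CARD('d) * CARD('d)) * spectral_norm A"
proof -
  have "linear ((*v) A)"
    by (rule linearI) (simp_all add: matrix_vector_right_distrib scaleR_eq_scale vector_scalar_commute)
  then have lin: "bounded_linear ((*v) A)" by (simp add: linear_conv_bounded_linear)
  have entry: "norm (A $ i $ j) \<le> spectral_norm A" for i j
  proof -
    have "norm (A $ i $ j) = norm ((A *v axis j 1) $ i)"
      by (simp add: matrix_vector_mult_def axis_def if_distrib[of "\<lambda>x. _ * x"] cong: if_cong)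
    also have "\<dots> \<le> norm (A *v axis j 1)" by (rule Finite_Cartesian_Product.norm_nth_le)
    also have "\<dots> \<le> spectral_norm A * norm (axis j 1 :: complex^'d)"
      unfolding spectral_norm_def by (rule onorm[OF lin])
    finally show ?thesis by (simp add: norm_axis_1)
  qed
  have "norm A \<le> (\<Sum>i\<in>UNIV. norm (A $ i))"
    unfolding norm_vec_def by (rule L2_set_le_sum) simp
  also have "\<dots> \<le> (\<Sum>i\<in>(UNIV::'d set). \<Sum>j\<in>(UNIV::'d set). norm (A $ i $ j))"
    unfolding norm_vec_def[of "A $ _"] by (intro sum_mono L2_set_le_sum) simp
  also have "\<dots> \<le> (\<Sum>i\<in>(UNIV::'d set). \<Sum>j\<in>(UNIV::'d set). spectral_norm A)"
    by (intro sum_mono entry)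
  finally show ?thesis by (simp add: mult.assoc)
qed

lemma suitable_imp_square_integrable:
  fixes F :: "'a \<Rightarrow> complex^'d^'d"
  assumes "suitable N F"
  shows "integrable N (\<lambda>z. (norm (F z))\<^sup>2)"
proof -
  let ?c = "real (CARD('d) * CARD('d))"
  have c: "?c > 0" by (simp add: card_gt_0_iff)
  have [measurable]: "F \<in> borel_measurable N" using assms by (simp add: suitable_def)
  have "integrable N (\<lambda>z. (norm (F z) / ?c)\<^sup>2)"
  proof (rule integrableI_bounded)
    show "(\<lambda>z. (norm (F z) / ?c)\<^sup>2) \<in> borel_measurable N" by measurable
    have "(\<integral>\<^sup>+z. ennreal (norm ((norm (F z) / ?c)\<^sup>2)) \<partial>N) \<le> (\<integral>\<^sup>+z. ennreal ((spectral_norm (F z))\<^sup>2) \<partial>N)"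
    proof (rule nn_integral_mono)
      fix z
      have "norm (F z) / ?c \<le> spectral_norm (F z)"
        using norm_le_spectral_norm[of "F z"] c by (simp only: pos_divide_le_eq mult.commute)
      then have "(norm (F z) / ?c)\<^sup>2 \<le> (spectral_norm (F z))\<^sup>2"
        by (rule power_mono) simp
      then show "ennreal (norm ((norm (F z) / ?c)\<^sup>2)) \<le> ennreal ((spectral_norm (F z))\<^sup>2)"
        by (simp add: ennreal_leI)
    qed
    also have "\<dots> < \<infinity>" using assms by (simp add: suitable_def)
    finally show "(\<integral>\<^sup>+z. ennreal (norm ((norm (F z) / ?c)\<^sup>2)) \<partial>N) < \<infinity>" .
  qed
  then have "integrable N (\<lambda>z. ?c\<^sup>2 * (norm (F z) / ?c)\<^sup>2)" by (rule integrable_mult_right)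
  then show ?thesis using c by (simp add: power_divide)
qed

locale product_matrix_function =
  fixes I :: "'i set" and M :: "'i \<Rightarrow> 'a measure" and f :: "('i \<Rightarrow> 'a) \<Rightarrow> complex^'d^'d"
  assumes finite_I: "finite I" and prob_M: "\<And>i. prob_space (M i)"
    and f_measurable [measurable]: "f \<in> borel_measurable (PiM I M)"
    and herm: "\<And>z. z \<in> space (PiM I M) \<Longrightarrow> hermitian (f z)"
    and square_integrable: "integrable (PiM I M) (\<lambda>z. (norm (f z))\<^sup>2)"
begin

abbreviation "P \<equiv> PiM I M"
abbreviation "PP \<equiv> P \<Otimes>\<^sub>M P"

sublocale P: prob_space P
  using prob_M by (rule prob_space_PiM)

sublocale PP: pair_prob_space P P ..

lemma measurable_mix [measurable]: "mix J \<in> measurable PP P"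
  unfolding mix_def[abs_def] by (intro measurable_override_on) auto

lemma distr_mix: "distr PP P (mix J) = P"
proof -
  have "distr PP P (mix J) = distr (distr PP PP (swap J)) P fst"
    by (simp add: distr_distr comp_def mix_eq_fst_swap[abs_def])
  also have "\<dots> = P"
    unfolding distr_swap[OF finite_I prob_M] by (rule P.distr_pair_fst)
  finally show ?thesis .
qed

lemma integral_swap:
  fixes h :: "_ \<Rightarrow> real"
  assumes "h \<in> borel_measurable PP" shows "(\<integral>w. h (swap K w) \<partial>PP) = (\<integral>w. h w \<partial>PP)"
  using integral_distr[OF measurable_swap assms, of K] by (simp add: distr_swap[OF finite_I prob_M])

lemma integral_mix:
  fixes g :: "_ \<Rightarrow> 'b::{banach, second_countable_topology}"
  assumes "g \<in> borel_measurable P" shows "(\<integral>w. g (mix J w) \<partial>PP) = (\<integral>z. g z \<partial>P)"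
  using integral_distr[OF measurable_mix assms, of J] by (simp add: distr_mix)

lemma nn_integral_mix:
  assumes "g \<in> borel_measurable P" shows "(\<integral>\<^sup>+w. g (mix J w) \<partial>PP) = (\<integral>\<^sup>+z. g z \<partial>P)"
  using nn_integral_distr[OF measurable_mix, of g J] assms by (simp add: distr_mix)

lemma integrable_mix:
  fixes g :: "_ \<Rightarrow> 'b::{banach, second_countable_topology}"
  assumes "integrable P g" shows "integrable PP (\<lambda>w. g (mix J w))"
  using integrable_distr[OF measurable_mix, of J g] assms by (simp add: distr_mix)

lemma mix_in_space: "w \<in> space PP \<Longrightarrow> mix J w \<in> space P"
  using measurable_mix by (rule measurable_space)

lemma mix_cong:
  assumes w: "w \<in> space PP" and eq: "J \<inter> I = K \<inter> I"
  shows "mix J w = mix K w"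
proof
  fix i show "mix J w i = mix K w i"
  proof (cases "i \<in> I")
    case True
    then have "i \<in> J \<longleftrightarrow> i \<in> K" using eq by blast
    then show ?thesis by (simp add: mix_def override_on_def)
  next
    case False
    then show ?thesis
      using w by (auto simp: mix_def override_on_def space_pair_measure space_PiM PiE_def extensional_def)
  qed
qed

lemma herm_mix: "w \<in> space PP \<Longrightarrow> hermitian (f (mix J w))"
  by (intro herm mix_in_space)

lemma integrable_f: "integrable P f"
proof (rule integrable_norm_cancel)
  show "integrable P (\<lambda>z. norm (f z))"
    by (rule P.square_integrable_imp_integrable[OF _ square_integrable]) measurable
qed measurable

lemma measurable_matrix_fun_mix [measurable (raw)]:
  assumes "continuous_on UNIV \<phi>"
  shows "(\<lambda>w. matrix_fun \<phi> (f (mix J w))) \<in> borel_measurable PP"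
  using assms by (rule borel_measurable_matrix_fun) (measurable, auto intro: herm_mix)

abbreviation square_diff :: "'i set \<Rightarrow> 'i set \<Rightarrow> ('i \<Rightarrow> 'a) \<times> ('i \<Rightarrow> 'a) \<Rightarrow> complex^'d^'d" where
  "square_diff J K w \<equiv> (f (mix J w) - f (mix K w)) ** (f (mix J w) - f (mix K w))"

lemma integrable_square_diff:
  "integrable PP (\<lambda>w. (f (mix J w) - f (mix K w)) ** (f (mix J w) - f (mix K w)))"
proof -
  obtain C where C: "\<And>A B. norm (A ** (B :: complex^'d^'d)) \<le> norm (A :: complex^'d^'d) * norm B * C"
    using bounded_bilinear.bounded[OF bounded_bilinear_matrix_mult] by blast
  show ?thesis
  proof (rule Bochner_Integration.integrable_bound)
    show "integrable PP (\<lambda>w. (2 * (norm (f (mix J w)))\<^sup>2 + 2 * (norm (f (mix K w)))\<^sup>2) * \<bar>C\<bar>)"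
      by (intro integrable_mult_left Bochner_Integration.integrable_add integrable_mult_right
          integrable_mix[OF square_integrable])
    show "AE w in PP. norm ((f (mix J w) - f (mix K w)) ** (f (mix J w) - f (mix K w)))
        \<le> norm ((2 * (norm (f (mix J w)))\<^sup>2 + 2 * (norm (f (mix K w)))\<^sup>2) * \<bar>C\<bar>)"
    proof (rule AE_I2)
      fix w
      let ?A = "f (mix J w)" and ?B = "f (mix K w)"
      have "norm ((?A - ?B) ** (?A - ?B)) \<le> (norm (?A - ?B))\<^sup>2 * C"
        using C[of "?A - ?B" "?A - ?B"] by (simp add: power2_eq_square)
      also have "\<dots> \<le> (norm (?A - ?B))\<^sup>2 * \<bar>C\<bar>"
        by (intro mult_left_mono) auto
      also have "\<dots> \<le> (norm ?A + norm ?B)\<^sup>2 * \<bar>C\<bar>"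
        by (intro mult_right_mono power_mono norm_triangle_ineq4) auto
      also have "\<dots> \<le> (2 * (norm ?A)\<^sup>2 + 2 * (norm ?B)\<^sup>2) * \<bar>C\<bar>"
        using sum_squares_bound[of "norm ?A" "norm ?B"]
        by (intro mult_right_mono) (auto simp: power2_sum)
      finally show "norm ((?A - ?B) ** (?A - ?B)) \<le> norm ((2 * (norm ?A)\<^sup>2 + 2 * (norm ?B)\<^sup>2) * \<bar>C\<bar>)"
        by simp
    qed
  qed measurable
qed

lemma integrable_inner_matrix_fun:
  fixes G :: "_ \<Rightarrow> complex^'d^'d"
  assumes G: "integrable PP G" and \<phi>: "continuous_on UNIV \<phi>" "\<And>x. \<bar>\<phi> x\<bar> \<le> c"
  shows "integrable PP (\<lambda>w. G w \<bullet> matrix_fun \<phi> (f (mix J w)))"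
proof (rule Bochner_Integration.integrable_bound)
  note [measurable] = borel_measurable_integrable[OF G]
  note [measurable] = measurable_matrix_fun_mix[OF \<phi>(1)]
  let ?c = "sqrt (real CARD('d)) * c"
  show "integrable PP (\<lambda>w. norm (G w) * ?c)"
    by (intro integrable_mult_left integrable_norm G)
  show "(\<lambda>w. G w \<bullet> matrix_fun \<phi> (f (mix J w))) \<in> borel_measurable PP"
    by measurable
  show "AE w in PP. norm (G w \<bullet> matrix_fun \<phi> (f (mix J w))) \<le> norm (norm (G w) * ?c)"
  proof (rule AE_I2)
    fix w assume "w \<in> space PP"
    have "norm (G w \<bullet> matrix_fun \<phi> (f (mix J w))) \<le> norm (G w) * norm (matrix_fun \<phi> (f (mix J w)))"
      using Cauchy_Schwarz_ineq2 by simp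
    also have "\<dots> \<le> norm (G w) * ?c"
      using norm_matrix_fun_le[OF herm_mix[OF \<open>w \<in> space PP\<close>] \<phi>(2)] by (intro mult_left_mono) auto
    finally show "norm (G w \<bullet> matrix_fun \<phi> (f (mix J w))) \<le> norm (norm (G w) * ?c)" by simp
  qed
qed

definition local_variance :: "'i \<Rightarrow> ('i \<Rightarrow> 'a) \<Rightarrow> complex^'d^'d" where
  "local_variance i z = matrix_expectation P
    (\<lambda>Z. (f z - f (z(i := Z i))) ** (f z - f (z(i := Z i))))"

lemma square_diff_pair: "square_diff {} {i} (z, Z) = (f z - f (z(i := Z i))) ** (f z - f (z(i := Z i)))"
proof -
  have "mix {i} (z, Z) = z(i := Z i)" by (auto simp: mix_def override_on_def)
  then show ?thesis by (simp add: mix_empty)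
qed

text \<open>For exceptional \<open>z\<close> the entrywise expectation may consist of default values, because
  the integrand need not be integrable; square integrability of \<open>f\<close> confines this to a
  null set.\<close>

lemma AE_local_variance:
  "AE z in P. integrable P (\<lambda>Z. square_diff {} {i} (z, Z)) \<and> local_variance i z = (\<integral>Z. square_diff {} {i} (z, Z) \<partial>P)"
  using PP.AE_integrable_fst'[OF integrable_square_diff[of "{}" "{i}"]]
  by eventually_elim (simp add: local_variance_def square_diff_pair matrix_expectation_eq_integral)

lemma inner_integral_square_diff:
  assumes z: "z \<in> space P" and X: "\<And>D. hermitian D \<Longrightarrow> 0 \<le> (D ** D) \<bullet> X"
    and int: "integrable P (\<lambda>Z. square_diff {} {i} (z, Z))"
  shows "0 \<le> (\<integral>Z. square_diff {} {i} (z, Z) \<partial>P) \<bullet> X"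
    and "(\<integral>\<^sup>+Z. ennreal (square_diff {} {i} (z, Z) \<bullet> X) \<partial>P) = ennreal ((\<integral>Z. square_diff {} {i} (z, Z) \<partial>P) \<bullet> X)"
proof -
  have nonneg: "0 \<le> square_diff {} {i} (z, Z) \<bullet> X" if "Z \<in> space P" for Z
    using z that by (intro X hermitian_diff herm_mix) (auto simp: space_pair_measure)
  have eq: "(\<integral>Z. square_diff {} {i} (z, Z) \<bullet> X \<partial>P) = (\<integral>Z. square_diff {} {i} (z, Z) \<partial>P) \<bullet> X"
    using int by (intro integral_inner_left)
  show "0 \<le> (\<integral>Z. square_diff {} {i} (z, Z) \<partial>P) \<bullet> X"
    unfolding eq[symmetric] by (intro integral_nonneg_AE AE_I2 nonneg)
  show "(\<integral>\<^sup>+Z. ennreal (square_diff {} {i} (z, Z) \<bullet> X) \<partial>P) = ennreal ((\<integral>Z. square_diff {} {i} (z, Z) \<partial>P) \<bullet> X)"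
    unfolding eq[symmetric] using int nonneg by (intro nn_integral_eq_integral integrable_inner_left AE_I2)
qed

lemma AE_local_variance_nonneg:
  "AE z in P. \<forall>U p. unitary_matrix U \<longrightarrow> (\<forall>k. 0 \<le> p k) \<longrightarrow> 0 \<le> local_variance i z \<bullet> diag_in U p"
  using AE_local_variance[of i] AE_space
proof eventually_elim
  case (elim z)
  show ?case
  proof (intro allI impI)
    fix U :: "complex^'d^'d" and p :: "'d \<Rightarrow> real"
    assume U: "unitary_matrix U" and p: "\<forall>k. 0 \<le> p k"
    have "0 \<le> (D ** D) \<bullet> diag_in U p" if "hermitian D" for D
      using trace_square_diag_in_nonneg[OF that U, of p] p
      by (simp add: Re_trace_mult_eq_inner[OF hermitian_square[OF that]])
    then show "0 \<le> local_variance i z \<bullet> diag_in U p"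
      using inner_integral_square_diff(1)[of z "diag_in U p" i] elim by simp
  qed
qed

lemma hermitian_local_variance:
  assumes z: "z \<in> space P" shows "hermitian (local_variance i z)"
proof -
  have "hermitian (square_diff {} {i} (z, Z))" if "Z \<in> space P" for Z
    using z that by (intro hermitian_square hermitian_diff herm_mix) (auto simp: space_pair_measure)
  then have cnj: "cnj (square_diff {} {i} (z, Z) $ j $ k) = square_diff {} {i} (z, Z) $ k $ j"
    if "Z \<in> space P" for Z j k
    using that by (metis conj_transpose_nth hermitian_def)
  have "cnj (local_variance i z $ j $ k) = local_variance i z $ k $ j" for j k
    unfolding local_variance_def square_diff_pair[symmetric] matrix_expectation_def vec_lambda_beta
      Bochner_Integration.integral_cnj[symmetric]
    by (rule Bochner_Integration.integral_cong[OF refl cnj])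
  then show ?thesis by (simp add: hermitian_def vec_eq_iff)
qed

lemma measurable_local_variance [measurable]: "local_variance i \<in> borel_measurable P"
proof -
  have entry: "local_variance i z $ j $ k = (\<integral>Z. square_diff {} {i} (z, Z) $ j $ k \<partial>P)" for z j k
    by (simp add: local_variance_def square_diff_pair matrix_expectation_def)
  show ?thesis
  proof (rule borel_measurable_matrix_entries)
    fix j k
    have [measurable]: "(\<lambda>X::complex^'d^'d. X $ j $ k) \<in> borel_measurable borel"
      by (intro borel_measurable_continuous_onI continuous_intros)
    show "(\<lambda>z. local_variance i z $ j $ k) \<in> borel_measurable P"
      unfolding entry
      by (rule P.borel_measurable_lebesgue_integral) (simp add: case_prod_beta', measurable)
  qed
qed

definition variance :: "('i \<Rightarrow> 'a) \<Rightarrow> complex^'d^'d" where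
  "variance z = (1/2) *\<^sub>R (\<Sum>i\<in>I. local_variance i z)"

lemma measurable_variance [measurable]: "variance \<in> borel_measurable P"
  unfolding variance_def[abs_def] by measurable

lemma hermitian_variance: "z \<in> space P \<Longrightarrow> hermitian (variance z)"
  using hermitian_local_variance[of z]
  by (simp add: variance_def hermitian_def vec_eq_iff)

lemma AE_variance_psd:
  "AE z in P. \<forall>U p. unitary_matrix U \<longrightarrow> (\<forall>k. 0 \<le> p k) \<longrightarrow> 0 \<le> Re (trace (variance z ** diag_in U p))"
proof -
  have "AE z in P. \<forall>i\<in>I. \<forall>U p. unitary_matrix U \<longrightarrow> (\<forall>k. 0 \<le> p k) \<longrightarrow> 0 \<le> local_variance i z \<bullet> diag_in U p"
    using AE_local_variance_nonneg finite_I by (intro AE_finite_allI)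
  then show ?thesis
    using AE_space
  proof eventually_elim
    case (elim z)
    then show ?case
      unfolding Re_trace_mult_eq_inner[OF hermitian_variance[OF elim(2)]]
      by (auto simp: variance_def inner_sum_left intro!: sum_nonneg)
  qed
qed

text \<open>Almost everywhere the spectrum of the variance lies in the nonnegative half line, so \<open>t powr
  q\<close> may be replaced by a function that is continuous on the whole line, as
  \<open>borel_measurable_matrix_fun\<close> requires.\<close>

lemma nn_integral_variance_powr:
  "(\<integral>\<^sup>+z. ennreal (Re (trace (matrix_fun (\<lambda>t. t powr q) (variance z)))) \<partial>P) =
   (\<integral>\<^sup>+z. ennreal (Re (trace (matrix_fun (\<lambda>t. max 0 t powr q) (variance z)))) \<partial>P)"
proof (rule nn_integral_cong_AE)
  show "AE z in P. ennreal (Re (trace (matrix_fun (\<lambda>t. t powr q) (variance z)))) =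
     ennreal (Re (trace (matrix_fun (\<lambda>t. max 0 t powr q) (variance z))))"
    using AE_variance_psd AE_space
  proof eventually_elim
    case (elim z)
    then have "matrix_fun (\<lambda>t. t powr q) (variance z) = matrix_fun (\<lambda>t. max 0 t powr q) (variance z)"
      by (intro matrix_fun_cong_psd hermitian_variance) auto
    then show ?case by simp
  qed
qed

end

section \<open>Averaging over the order of replacement\<close>

lemma sum_inverse_sqrt_le: "(\<Sum>l=1..n. 1 / sqrt (real l)) \<le> 2 * sqrt (real n)"
proof (induction n)
  case (Suc n)
  let ?a = "sqrt (real n)" and ?b = "sqrt (real (Suc n))"
  have b: "?b > 0" "?a \<le> ?b" by simp_all
  have "1 = (?b + ?a) * (?b - ?a)"
    by (simp add: square_diff_square_factored[symmetric] algebra_simps)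
  also have "\<dots> \<le> (2 * ?b) * (?b - ?a)"
    using b by (intro mult_right_mono) auto
  finally have "1 / ?b \<le> 2 * (?b - ?a)"
    by (simp only: pos_divide_le_eq[OF b(1)] mult_ac)
  then show ?case using Suc.IH by simp
qed simp

text \<open>Removing elements one at a time leads from \<open>A I\<close> to \<open>A {}\<close>. Averaging each
  step over the element removed, by induction on the size of \<open>R\<close>, amounts to removing
  the elements in a uniformly random order. With \<open>n\<close> elements in all, at size
  \<open>l\<close> the average of \<open>a i\<close> is at most \<open>2B/n\<close> and that of
  \<open>b i R\<close> at most \<open>2B/l\<close>; the choice \<open>s = sqrt (n/l)\<close>
  balances the two.\<close>

lemma subset_averaging:
  fixes A :: "'i set \<Rightarrow> real" and a :: "'i \<Rightarrow> real" and b :: "'i \<Rightarrow> 'i set \<Rightarrow> real"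
  assumes fin: "finite I" and B: "0 \<le> B" and empty: "A {} \<le> 0"
    and step: "\<And>R i s. R \<subseteq> I \<Longrightarrow> i \<in> R \<Longrightarrow> 0 < s \<Longrightarrow> A R - A (R - {i}) \<le> (s * a i + b i R / s) / 4"
    and a: "(\<Sum>i\<in>I. a i) \<le> 2 * B"
    and b: "\<And>R. R \<subseteq> I \<Longrightarrow> (\<Sum>i\<in>R. b i R) \<le> 2 * B"
  shows "A I \<le> 2 * B"
proof (cases "I = {}")
  case True
  then show ?thesis using empty B by simp
next
  case False
  define n where "n = real (card I)"
  have n: "n > 0" using False fin by (simp add: n_def card_gt_0_iff)
  define s where "s l = sqrt (n / real l)" for l :: nat
  define S where "S m = (\<Sum>l=1..m. s l)" for m
  define \<beta> where "\<beta> m = (\<Sum>l=1..m. 1 / (2 * (real l * s l)))" for m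
  have main: "A R \<le> S (card R) / (4 * real (card R)) * (\<Sum>i\<in>R. a i) + \<beta> (card R) * B" if "R \<subseteq> I" for R
    using that
  proof (induction "card R" arbitrary: R)
    case 0
    then have "R = {}" using fin finite_subset by fastforce
    then show ?case using empty by (simp add: \<beta>_def)
  next
    case (Suc m)
    have finR: "finite R" using Suc.prems fin finite_subset by blast
    let ?s = "s (Suc m)" and ?\<Sigma> = "\<Sum>i\<in>R. a i"
    have s: "?s > 0" using n by (simp add: s_def)
    have card: "real (card R) = 1 + real m" using Suc.hyps(2) by (simp flip: Suc.hyps(2))
    have "A R \<le> S m / (4 * real m) * (?\<Sigma> - a i) + \<beta> m * B + (?s * a i + b i R / ?s) / 4" if "i \<in> R" for i
    proof -
      have "card (R - {i}) = m" using that Suc.hyps(2) finR by simp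
      then have "A (R - {i}) \<le> S m / (4 * real m) * (\<Sum>j\<in>R - {i}. a j) + \<beta> m * B"
        using Suc.hyps(1)[of "R - {i}"] Suc.prems by auto
      moreover have "(\<Sum>j\<in>R - {i}. a j) = ?\<Sigma> - a i"
        using that finR by (simp add: sum_diff1)
      ultimately have "A (R - {i}) \<le> S m / (4 * real m) * (?\<Sigma> - a i) + \<beta> m * B"
        by (simp only:)
      then show ?thesis
        using step[OF Suc.prems that s] by linarith
    qed
    then have "(\<Sum>i\<in>R. A R) \<le>
        (\<Sum>i\<in>R. S m / (4 * real m) * (?\<Sigma> - a i) + \<beta> m * B + (?s * a i + b i R / ?s) / 4)"
      by (rule sum_mono)
    also have "\<dots> = S m / (4 * real m) * (real (card R) * ?\<Sigma> - ?\<Sigma>) + real (card R) * (\<beta> m * B)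
        + (?s * ?\<Sigma> + (\<Sum>i\<in>R. b i R) / ?s) / 4"
      by (simp add: sum.distrib sum_subtractf sum_distrib_left[symmetric] sum_divide_distrib[symmetric])
    also have "S m / (4 * real m) * (real (card R) * ?\<Sigma> - ?\<Sigma>) = S m / 4 * ?\<Sigma>"
      by (cases "m = 0") (simp_all add: card S_def field_simps)
    also have "(?s * ?\<Sigma> + (\<Sum>i\<in>R. b i R) / ?s) / 4 \<le> (?s * ?\<Sigma> + 2 * B / ?s) / 4"
      using b[OF Suc.prems] s by (intro divide_right_mono add_left_mono) auto
    finally have "real (card R) * A R \<le> (S m + ?s) / 4 * ?\<Sigma> + (real (card R) * \<beta> m * B + 2 * B / ?s / 4)"
      by (simp add: algebra_simps add_divide_distrib)
    also have "S m + ?s = S (Suc m)" by (simp add: S_def)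
    also have "real (card R) * \<beta> m * B + 2 * B / ?s / 4 = real (card R) * (\<beta> (Suc m) * B)"
    proof -
      have "\<beta> (Suc m) = \<beta> m + 1 / (2 * (real (card R) * ?s))" by (simp add: \<beta>_def card)
      moreover have "real (card R) \<noteq> 0" by (simp add: card)
      ultimately show ?thesis using s by (simp add: field_simps)
    qed
    finally have "A R \<le> (S (Suc m) / 4 * ?\<Sigma> + real (card R) * (\<beta> (Suc m) * B)) / real (card R)"
      by (subst le_divide_eq) (simp_all add: card mult.commute)
    also have "\<dots> = S (Suc m) / (4 * real (card R)) * ?\<Sigma> + \<beta> (Suc m) * B"
      using card by (simp add: add_divide_distrib)
    finally show ?case unfolding Suc.hyps(2) .
  qed
  (* Both weights reduce to the same harmonic sum of inverse square roots. *)
  have s_eq: "s l / n = 1 / (sqrt n * sqrt (real l))" and ls_eq: "real l * s l = sqrt n * sqrt (real l)" if "l \<ge> 1" for l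
    using n that by (simp_all add: s_def real_sqrt_divide real_div_sqrt field_simps)
  let ?h = "\<Sum>l=1..card I. 1 / sqrt (real l)"
  have "S (card I) / n = (\<Sum>l=1..card I. s l / n)" by (simp add: S_def sum_divide_distrib)
  also have "\<dots> = (\<Sum>l=1..card I. 1 / sqrt n * (1 / sqrt (real l)))"
    by (intro sum.cong refl) (simp add: s_eq)
  finally have 1: "S (card I) / n = ?h / sqrt n" by (simp add: sum_divide_distrib mult.commute)
  have "\<beta> (card I) = (\<Sum>l=1..card I. 1 / (2 * sqrt n) * (1 / sqrt (real l)))"
    unfolding \<beta>_def by (intro sum.cong refl) (simp add: ls_eq)
  then have 2: "\<beta> (card I) = ?h / (2 * sqrt n)" by (simp add: sum_divide_distrib mult_ac)
  have "A I \<le> S (card I) / (4 * n) * (\<Sum>i\<in>I. a i) + \<beta> (card I) * B"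
    using main[OF order_refl] by (simp add: n_def)
  also have "S (card I) / (4 * n) = ?h / sqrt n / 4" by (simp only: 1[symmetric]) simp
  also have "?h / sqrt n / 4 * (\<Sum>i\<in>I. a i) \<le> ?h / sqrt n / 4 * (2 * B)"
    using n by (intro mult_left_mono a) (simp add: sum_nonneg)
  also have "?h / sqrt n / 4 * (2 * B) + \<beta> (card I) * B = ?h / sqrt n * B"
    unfolding 2 by (simp add: field_simps)
  also have "\<dots> \<le> 2 * B"
  proof (rule mult_right_mono[OF _ B])
    show "?h / sqrt n \<le> 2"
      using sum_inverse_sqrt_le[of "card I"] n by (simp add: divide_le_eq n_def)
  qed
  finally show ?thesis by simp
qed

section \<open>Replacing coordinates one at a time\<close>

text \<open>The hypotheses on the test function \<open>\<phi>\<close> and its weight \<open>\<psi>\<close>.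
  Boundedness makes every expectation below finite for square integrable \<open>f\<close>; the last
  hypothesis replaces the convexity of \<open>\<bar>\<phi>'\<bar>\<close> and, unlike convexity,
  survives truncation.\<close>

locale mean_value_pair = product_matrix_function I M f
  for I :: "'i set" and M :: "'i \<Rightarrow> 'a measure" and f :: "('i \<Rightarrow> 'a) \<Rightarrow> complex^'d^'d" +
  fixes \<phi> \<psi> :: "real \<Rightarrow> real" and c :: real
  assumes continuous_\<phi>: "continuous_on UNIV \<phi>" and continuous_\<psi>: "continuous_on UNIV \<psi>"
    and bounded_\<phi>: "\<And>x. \<bar>\<phi> x\<bar> \<le> c" and bounded_\<psi>: "\<And>x. \<bar>\<psi> x\<bar> \<le> c"
    and nonneg_\<psi>: "\<And>x. 0 \<le> \<psi> x"
    and mean_value: "\<And>x y. \<bar>\<phi> x - \<phi> y\<bar> \<le> \<bar>x - y\<bar> * (\<psi> x + \<psi> y) / 2"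
begin

definition correlation :: "'i set \<Rightarrow> 'i set \<Rightarrow> real" where
  "correlation J K = (\<integral>w. f (mix J w) \<bullet> matrix_fun \<phi> (f (mix K w)) \<partial>PP)"

definition energy :: "'i set \<Rightarrow> 'i set \<Rightarrow> 'i set \<Rightarrow> real" where
  "energy J K L = (\<integral>w. square_diff J K w \<bullet> matrix_fun \<psi> (f (mix L w)) \<partial>PP)"

lemmas [measurable] = measurable_matrix_fun_mix[OF continuous_\<phi>] measurable_matrix_fun_mix[OF continuous_\<psi>]

lemma integrable_correlation: "integrable PP (\<lambda>w. f (mix J w) \<bullet> matrix_fun \<phi> (f (mix K w)))"
  by (rule integrable_inner_matrix_fun[OF integrable_mix[OF integrable_f] continuous_\<phi> bounded_\<phi>])

lemma integrable_energy: "integrable PP (\<lambda>w. square_diff J K w \<bullet> matrix_fun \<psi> (f (mix L w)))"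
  by (rule integrable_inner_matrix_fun[OF integrable_square_diff continuous_\<psi> bounded_\<psi>])

lemma correlation_swap: "correlation (sym_diff J L) (sym_diff K L) = correlation J K"
  unfolding correlation_def mix_swap[symmetric] by (rule integral_swap) measurable

lemma energy_swap: "energy (sym_diff J N) (sym_diff K N) (sym_diff L N) = energy J K L"
  unfolding energy_def mix_swap[symmetric] by (rule integral_swap) measurable

lemma energy_commute: "energy J K L = energy K J L"
  unfolding energy_def by (subst matrix_square_diff_commute) simp

text \<open>The exchange of coordinate \<open>i\<close> antisymmetrises the left side, which makes the mean
  value inequality applicable. On the right, exchanging the coordinates in \<open>J\<close> carries
  the difference of \<open>f\<close> at \<open>mix J\<close> and \<open>mix (insert i J)\<close> to
  the difference at \<open>mix {}\<close> and \<open>mix {i}\<close>, at the price of moving the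
  weight from \<open>mix {}\<close> to \<open>mix J\<close>.\<close>

lemma correlation_step:
  assumes i: "i \<notin> J" and s: "0 < s"
  shows "correlation J {} - correlation (insert i J) {} \<le> (s * energy {} {i} {} + energy {} {i} J / s) / 4"
proof -
  let ?J = "insert i J"
  have sd: "sym_diff J {i} = ?J" "sym_diff ?J {i} = J" "sym_diff {} {i} = {i}" "sym_diff {i} {i} = {}"
    "sym_diff J J = {}" "sym_diff ?J J = {i}" "sym_diff {} J = J"
    using i by auto
  (* The exchange of coordinate i maps J to ?J and {} to {i}, and conversely. *)
  have "2 * (correlation J {} - correlation ?J {}) =
      correlation J {} - correlation ?J {} - (correlation J {i} - correlation ?J {i})"
    using correlation_swap[of J "{i}" "{}"] correlation_swap[of ?J "{i}" "{}"] unfolding sd by simp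
  also have "\<dots> = (\<integral>w. (f (mix J w) - f (mix ?J w)) \<bullet>
      (matrix_fun \<phi> (f (mix {} w)) - matrix_fun \<phi> (f (mix {i} w))) \<partial>PP)"
    unfolding correlation_def inner_diff_left inner_diff_right
    by (simp add: Bochner_Integration.integral_diff integrable_correlation algebra_simps)
  also have "\<dots> \<le> (\<integral>w. (s * (square_diff {} {i} w \<bullet> matrix_fun \<psi> (f (mix {} w))
          + square_diff {} {i} w \<bullet> matrix_fun \<psi> (f (mix {i} w)))
      + (square_diff J ?J w \<bullet> matrix_fun \<psi> (f (mix {} w))
          + square_diff J ?J w \<bullet> matrix_fun \<psi> (f (mix {i} w))) / s) / 4 \<partial>PP)"
  proof (rule integral_mono)
    show "integrable PP (\<lambda>w. (f (mix J w) - f (mix ?J w)) \<bullet>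
        (matrix_fun \<phi> (f (mix {} w)) - matrix_fun \<phi> (f (mix {i} w))))"
      unfolding inner_diff_left inner_diff_right
      by (intro Bochner_Integration.integrable_diff integrable_correlation)
  next
    show "integrable PP (\<lambda>w. (s * (square_diff {} {i} w \<bullet> matrix_fun \<psi> (f (mix {} w))
          + square_diff {} {i} w \<bullet> matrix_fun \<psi> (f (mix {i} w)))
      + (square_diff J ?J w \<bullet> matrix_fun \<psi> (f (mix {} w))
          + square_diff J ?J w \<bullet> matrix_fun \<psi> (f (mix {i} w))) / s) / 4)"
      by (intro integrable_divide Bochner_Integration.integrable_add integrable_mult_right integrable_energy)
  next
    fix w assume w: "w \<in> space PP"
    note h = herm_mix[OF w] and hd = hermitian_diff[OF herm_mix[OF w] herm_mix[OF w]]
    show "(f (mix J w) - f (mix ?J w)) \<bullet> (matrix_fun \<phi> (f (mix {} w)) - matrix_fun \<phi> (f (mix {i} w)))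
      \<le> (s * (square_diff {} {i} w \<bullet> matrix_fun \<psi> (f (mix {} w))
          + square_diff {} {i} w \<bullet> matrix_fun \<psi> (f (mix {i} w)))
      + (square_diff J ?J w \<bullet> matrix_fun \<psi> (f (mix {} w))
          + square_diff J ?J w \<bullet> matrix_fun \<psi> (f (mix {i} w))) / s) / 4"
      using mean_value_trace_inequality[OF h h hd s nonneg_\<psi> mean_value, of J ?J "{}" "{i}"]
      by (simp add: Re_trace_mult_eq_inner hd hermitian_square)
  qed
  also have "\<dots> = (s * (energy {} {i} {} + energy {} {i} {i}) + (energy J ?J {} + energy J ?J {i}) / s) / 4"
    unfolding energy_def by (simp add: integrable_energy)
  also have "\<dots> = (s * energy {} {i} {} + energy {} {i} J / s) / 2"
  proof -
    have "energy {} {i} {i} = energy {} {i} {}"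
      using energy_swap[of "{}" "{i}" "{i}" "{}"] energy_commute unfolding sd by metis
    moreover have "energy J ?J {i} = energy J ?J {}"
      using energy_swap[of J "{i}" ?J "{}"] energy_commute unfolding sd by metis
    moreover have "energy J ?J {} = energy {} {i} J"
      using energy_swap[of J J ?J "{}"] unfolding sd by simp
    ultimately show ?thesis by (simp add: field_simps)
  qed
  finally show ?thesis by simp
qed

text \<open>If \<open>i\<close> is not in \<open>J\<close>, the weight does not depend on the coordinate
  \<open>Z i\<close>, which can therefore be integrated out separately.\<close>

lemma energy_eq_local_variance:
  assumes i: "i \<notin> J"
  shows "ennreal (energy {} {i} J) =
    (\<integral>\<^sup>+z. \<integral>\<^sup>+Z. ennreal (local_variance i z \<bullet> matrix_fun \<psi> (f (mix J (z, Z)))) \<partial>P \<partial>P)"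
proof -
  let ?h = "\<lambda>w. ennreal (square_diff {} {i} w \<bullet> matrix_fun \<psi> (f (mix J w)))"
  have "ennreal (energy {} {i} J) = (\<integral>\<^sup>+w. ?h w \<partial>PP)"
    unfolding energy_def
    by (intro nn_integral_eq_integral[symmetric] integrable_energy AE_I2 square_inner_matrix_fun_nonneg
        hermitian_diff herm_mix nonneg_\<psi>)
  also have "\<dots> = (\<integral>\<^sup>+z. \<integral>\<^sup>+Z. ?h (z, Z) \<partial>P \<partial>P)"
    by (rule P.nn_integral_fst[symmetric]) measurable
  also have "\<dots> = (\<integral>\<^sup>+z. \<integral>\<^sup>+Z. ennreal (local_variance i z \<bullet> matrix_fun \<psi> (f (mix J (z, Z)))) \<partial>P \<partial>P)"
  proof (intro nn_integral_cong_AE)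
    show "AE z in P. (\<integral>\<^sup>+Z. ?h (z, Z) \<partial>P) =
        (\<integral>\<^sup>+Z. ennreal (local_variance i z \<bullet> matrix_fun \<psi> (f (mix J (z, Z)))) \<partial>P)"
      using AE_local_variance[of i] AE_space
    proof eventually_elim
      case (elim z)
      then have z: "z \<in> space P" by simp
      have h [measurable]: "(\<lambda>Z. ?h (z, Z)) \<in> borel_measurable P"
        using z by measurable
      (* Only the i-th coordinate of the last point matters, and the law of Z is also that of Z with
         this coordinate taken from a further copy Z'. *)
      have indep: "?h (z, mix {i} (Z, Z')) = ennreal (square_diff {} {i} (z, Z') \<bullet> matrix_fun \<psi> (f (mix J (z, Z))))" for Z Z'
      proof -
        have "mix {i} (z, mix {i} (Z, Z')) = mix {i} (z, Z')" "mix J (z, mix {i} (Z, Z')) = mix J (z, Z)"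
          using i by (auto simp: mix_def override_on_def fun_eq_iff)
        then show ?thesis by (simp add: mix_empty)
      qed
      have "(\<integral>\<^sup>+Z. ?h (z, Z) \<partial>P) = (\<integral>\<^sup>+v. ?h (z, mix {i} v) \<partial>PP)"
        by (rule nn_integral_mix[symmetric, OF h])
      also have "\<dots> = (\<integral>\<^sup>+Z. \<integral>\<^sup>+Z'. ?h (z, mix {i} (Z, Z')) \<partial>P \<partial>P)"
        using z by (intro P.nn_integral_fst[symmetric]) measurable
      also have "\<dots> = (\<integral>\<^sup>+Z. ennreal (local_variance i z \<bullet> matrix_fun \<psi> (f (mix J (z, Z)))) \<partial>P)"
        unfolding indep
        using elim z by (intro nn_integral_cong)
          (auto simp: space_pair_measure intro!: inner_integral_square_diff(2) square_inner_matrix_fun_nonneg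
            nonneg_\<psi> herm_mix)
      finally show ?case .
    qed
  qed
  finally show ?thesis .
qed

text \<open>The terms with \<open>i\<close> outside \<open>R\<close>, missing from the left side, can be added
  because they are nonnegative.\<close>

lemma sum_energy_le:
  assumes J: "J \<inter> R = {}" and R: "R \<subseteq> I"
  shows "ennreal (\<Sum>i\<in>R. energy {} {i} J) \<le>
    (\<integral>\<^sup>+z. \<integral>\<^sup>+Z. ennreal ((\<Sum>i\<in>I. local_variance i z) \<bullet> matrix_fun \<psi> (f (mix J (z, Z)))) \<partial>P \<partial>P)"
proof -
  let ?g = "\<lambda>i w. ennreal (local_variance i (fst w) \<bullet> matrix_fun \<psi> (f (mix J w)))"
  have fin: "finite R" using R finite_I finite_subset by blast
  have "0 \<le> energy {} {i} J" for i
    unfolding energy_def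
    by (intro integral_nonneg_AE AE_I2 square_inner_matrix_fun_nonneg hermitian_diff herm_mix nonneg_\<psi>)
  then have "ennreal (\<Sum>i\<in>R. energy {} {i} J) = (\<Sum>i\<in>R. ennreal (energy {} {i} J))"
    by (simp add: sum_ennreal)
  also have "\<dots> = (\<Sum>i\<in>R. \<integral>\<^sup>+z. \<integral>\<^sup>+Z. ?g i (z, Z) \<partial>P \<partial>P)"
  proof (intro sum.cong refl)
    fix i assume "i \<in> R"
    then have "i \<notin> J" using J by blast
    then show "ennreal (energy {} {i} J) = (\<integral>\<^sup>+z. \<integral>\<^sup>+Z. ?g i (z, Z) \<partial>P \<partial>P)"
      by (simp add: energy_eq_local_variance)
  qed
  also have "\<dots> = (\<Sum>i\<in>R. \<integral>\<^sup>+w. ?g i w \<partial>PP)"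
    by (intro sum.cong refl P.nn_integral_fst) measurable
  also have "\<dots> = (\<integral>\<^sup>+w. (\<Sum>i\<in>R. ?g i w) \<partial>PP)"
    by (intro nn_integral_sum[symmetric]) measurable
  also have "\<dots> = (\<integral>\<^sup>+z. \<integral>\<^sup>+Z. (\<Sum>i\<in>R. ?g i (z, Z)) \<partial>P \<partial>P)"
    by (rule P.nn_integral_fst[symmetric]) measurable
  also have "\<dots> \<le> (\<integral>\<^sup>+z. \<integral>\<^sup>+Z. ennreal ((\<Sum>i\<in>I. local_variance i z) \<bullet> matrix_fun \<psi> (f (mix J (z, Z)))) \<partial>P \<partial>P)"
  proof (rule nn_integral_mono_AE)
    have "AE z in P. \<forall>i\<in>I. integrable P (\<lambda>Z. square_diff {} {i} (z, Z)) \<and>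
        local_variance i z = (\<integral>Z. square_diff {} {i} (z, Z) \<partial>P)"
      using AE_local_variance finite_I by (intro AE_finite_allI)
    then show "AE z in P. (\<integral>\<^sup>+Z. (\<Sum>i\<in>R. ?g i (z, Z)) \<partial>P) \<le>
        (\<integral>\<^sup>+Z. ennreal ((\<Sum>i\<in>I. local_variance i z) \<bullet> matrix_fun \<psi> (f (mix J (z, Z)))) \<partial>P)"
      using AE_space
    proof eventually_elim
      case (elim z)
      show ?case
      proof (rule nn_integral_mono)
        fix Z assume "Z \<in> space P"
        then have "hermitian (f (mix J (z, Z)))"
          using elim by (intro herm_mix) (simp add: space_pair_measure)
        then have nonneg: "0 \<le> local_variance i z \<bullet> matrix_fun \<psi> (f (mix J (z, Z)))" if "i \<in> I" for i
          using elim that inner_integral_square_diff(1)[OF _ square_inner_matrix_fun_nonneg] nonneg_\<psi> by simp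
        have "(\<Sum>i\<in>R. ?g i (z, Z)) = ennreal (\<Sum>i\<in>R. local_variance i z \<bullet> matrix_fun \<psi> (f (mix J (z, Z))))"
          using R nonneg by (subst sum_ennreal[symmetric]) auto
        also have "\<dots> \<le> ennreal (\<Sum>i\<in>I. local_variance i z \<bullet> matrix_fun \<psi> (f (mix J (z, Z))))"
          using R nonneg finite_I by (intro ennreal_leI sum_mono2) auto
        finally show "(\<Sum>i\<in>R. ?g i (z, Z)) \<le>
            ennreal ((\<Sum>i\<in>I. local_variance i z) \<bullet> matrix_fun \<psi> (f (mix J (z, Z))))"
          by (simp add: inner_sum_left)
      qed
    qed
  qed
  finally show ?thesis .
qed

text \<open>The correlation of \<open>f(mix J)\<close> with \<open>\<phi>(f(z))\<close> is followed from the
  empty \<open>J\<close>, where it is the integral to be bounded, to the full \<open>J\<close>,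
  where independence and \<open>E f = 0\<close> make it vanish. In terms of the set \<open>R = -
  J\<close> of coordinates still taken from \<open>z\<close>, this is the situation of
  \<open>subset_averaging\<close>.\<close>

lemma correlation_le_of_local_variance:
  assumes B: "0 \<le> B" and centered: "(\<integral>z. f z \<partial>P) = 0"
    and bound: "\<And>J. (\<integral>\<^sup>+z. \<integral>\<^sup>+Z. ennreal ((\<Sum>i\<in>I. local_variance i z) \<bullet> matrix_fun \<psi> (f (mix J (z, Z)))) \<partial>P \<partial>P)
      \<le> ennreal (2 * B)"
  shows "(\<integral>z. f z \<bullet> matrix_fun \<phi> (f z) \<partial>P) \<le> 2 * B"
proof -
  have sum_le: "(\<Sum>i\<in>R. energy {} {i} J) \<le> 2 * B" if "J \<inter> R = {}" "R \<subseteq> I" for R J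
  proof -
    have "ennreal (\<Sum>i\<in>R. energy {} {i} J) \<le> ennreal (2 * B)"
      using sum_energy_le[OF that] bound[of J] by (rule order_trans)
    then show ?thesis using B by (simp add: ennreal_le_iff)
  qed
  have "correlation (- I) {} \<le> 2 * B"
  proof (rule subset_averaging[OF finite_I B,
        where A = "\<lambda>R. correlation (- R) {}" and a = "\<lambda>i. energy {} {i} {}" and b = "\<lambda>i R. energy {} {i} (- R)"])
    have "correlation UNIV {} = (\<integral>z. \<integral>Z. f Z \<bullet> matrix_fun \<phi> (f z) \<partial>P \<partial>P)"
      using PP.integral_fst'[OF integrable_correlation[of UNIV "{}"]]
      by (simp add: correlation_def mix_empty mix_UNIV)
    also have "\<dots> = 0"
      by (simp add: integral_inner_left integrable_f centered)
    finally show "correlation (- {}) {} \<le> 0" by simp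
  next
    fix R i and s :: real assume "R \<subseteq> I" "i \<in> R" "0 < s"
    then show "correlation (- R) {} - correlation (- (R - {i})) {} \<le>
        (s * energy {} {i} {} + energy {} {i} (- R) / s) / 4"
      using correlation_step[of i "- R" s] by (simp add: Compl_Diff_eq)
  qed (use sum_le[of "{}"] sum_le in auto)
  also have "correlation (- I) {} = (\<integral>w. f (mix {} w) \<bullet> matrix_fun \<phi> (f (mix {} w)) \<partial>PP)"
    unfolding correlation_def by (intro Bochner_Integration.integral_cong refl) (simp add: mix_cong[of _ "- I" "{}"])
  also have "\<dots> = (\<integral>z. f z \<bullet> matrix_fun \<phi> (f z) \<partial>P)"
  proof -
    have [measurable]: "(\<lambda>z. matrix_fun \<phi> (f z)) \<in> borel_measurable P"
      by (rule borel_measurable_matrix_fun[OF continuous_\<phi> f_measurable herm])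
    show ?thesis by (rule integral_mix) measurable
  qed
  finally show ?thesis .
qed

end

section \<open>Truncated odd powers\<close>

definition clip :: "real \<Rightarrow> real \<Rightarrow> real" where "clip T x = max (- T) (min T x)"

definition odd_powr :: "real \<Rightarrow> real \<Rightarrow> real" where "odd_powr p x = sgn x * \<bar>x\<bar> powr p"

text \<open>The value at \<open>r = 0\<close> is set apart because \<open>0 powr 0 = 0\<close>, while the
  derivative of \<open>odd_powr 1\<close> is one everywhere.\<close>

definition even_powr :: "real \<Rightarrow> real \<Rightarrow> real" where
  "even_powr r x = (if r = 0 then 1 else \<bar>x\<bar> powr r)"

lemma continuous_clip: "continuous_on UNIV (clip T)"
  unfolding clip_def[abs_def] by (intro continuous_intros)

lemma abs_clip_le: "0 \<le> T \<Longrightarrow> \<bar>clip T x\<bar> \<le> T" "0 \<le> T \<Longrightarrow> \<bar>clip T x\<bar> \<le> \<bar>x\<bar>"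
  by (auto simp: clip_def)

lemma clip_eq: "\<bar>x\<bar> \<le> T \<Longrightarrow> clip T x = x"
  by (auto simp: clip_def)

lemma clip_lipschitz: "\<bar>clip T x - clip T y\<bar> \<le> \<bar>x - y\<bar>"
  by (auto simp: clip_def max_def min_def abs_if)

lemma even_powr_nonneg: "0 \<le> even_powr r x"
  by (simp add: even_powr_def)

lemma even_powr_mono: "0 \<le> r \<Longrightarrow> \<bar>x\<bar> \<le> y \<Longrightarrow> even_powr r x \<le> even_powr r y"
  by (auto simp: even_powr_def intro!: powr_mono2)

lemma continuous_even_powr: "0 \<le> r \<Longrightarrow> continuous_on UNIV (even_powr r)"
  unfolding even_powr_def[abs_def]
  by (cases "r = 0")
    (auto intro!: continuous_on_powr' continuous_on_rabs continuous_on_id continuous_on_const)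

lemma continuous_odd_powr: "0 < p \<Longrightarrow> continuous_on UNIV (odd_powr p)"
proof -
  assume p: "0 < p"
  have "odd_powr p = (\<lambda>x. \<bar>max 0 x\<bar> powr p - \<bar>min 0 x\<bar> powr p)"
    by (auto simp: odd_powr_def fun_eq_iff max_def min_def sgn_if)
  then show ?thesis
    using p by (auto intro!: continuous_on_powr' continuous_on_diff continuous_on_minus continuous_on_max continuous_on_min
        continuous_on_rabs continuous_on_id continuous_on_const)
qed

text \<open>The trapezoidal rule overestimates the integral of the convex function \<open>p t^(p-1)\<close>. The
  difference of the two sides is increasing in \<open>x\<close>, by the tangent inequality for
  \<open>t^(p-1)\<close>, and vanishes at \<open>x = y\<close>.\<close>

lemma convex_powr_trapezoid:
  fixes p x y :: real
  assumes p: "2 \<le> p" and xy: "0 < y" "y \<le> x"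
  shows "x powr p - y powr p \<le> (x - y) * (p * x powr (p - 1) + p * y powr (p - 1)) / 2"
proof -
  define h where "h t = (t - y) * (p * t powr (p - 1) + p * y powr (p - 1)) / 2 - t powr p" for t
  have "h y \<le> h x"
  proof (rule DERIV_nonneg_imp_nondecreasing[OF xy(2)])
    fix t assume t: "y \<le> t" "t \<le> x"
    then have t0: "t > 0" using xy(1) by simp
    let ?d = "p / 2 * (y powr (p - 1) - t powr (p - 1) + (t - y) * ((p - 1) * t powr (p - 2)))"
    have "(h has_real_derivative ?d) (at t)"
      unfolding h_def[abs_def] using t0
      by (auto intro!: derivative_eq_intros simp: field_simps)
    moreover have "0 \<le> ?d"
    proof (cases "y = t")
      case False
      with t have yt: "y < t" by simp
      have "\<exists>u>y. u < t \<and> t powr (p - 1) - y powr (p - 1) = (t - y) * ((p - 1) * u powr (p - 2))"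
      proof (rule MVT2[OF yt])
        fix u assume "y \<le> u" "u \<le> t"
        then have "u > 0" using xy(1) by simp
        then show "((\<lambda>t. t powr (p - 1)) has_real_derivative (p - 1) * u powr (p - 2)) (at u)"
          by (auto intro!: derivative_eq_intros)
      qed
      then obtain u where u: "y < u" "u < t"
        and eq: "t powr (p - 1) - y powr (p - 1) = (t - y) * ((p - 1) * u powr (p - 2))" by blast
      have "u powr (p - 2) \<le> t powr (p - 2)"
        using u xy(1) p by (intro powr_mono2) auto
      then have "(t - y) * ((p - 1) * u powr (p - 2)) \<le> (t - y) * ((p - 1) * t powr (p - 2))"
        using yt p by (intro mult_left_mono) auto
      then show ?thesis using eq p by simp
    qed simp
    ultimately show "\<exists>d. (h has_real_derivative d) (at t) \<and> 0 \<le> d" by blast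
  qed
  then show ?thesis by (simp add: h_def)
qed

text \<open>For arguments of equal sign this is the trapezoidal bound above; for opposite signs the factor
  \<open>p/2 \<ge> 1\<close> alone suffices.\<close>

lemma odd_powr_trapezoid:
  assumes p: "p = 1 \<or> 2 \<le> p"
  shows "\<bar>odd_powr p x - odd_powr p y\<bar> \<le> \<bar>x - y\<bar> * (p * even_powr (p - 1) x + p * even_powr (p - 1) y) / 2"
  using p
proof
  assume "p = 1"
  have "odd_powr 1 x = x" for x by (simp add: odd_powr_def powr_one sgn_mult_abs)
  then show ?thesis using \<open>p = 1\<close> by (simp add: even_powr_def)
next
  assume p: "2 \<le> p"
  have mult: "t * t powr (p - 1) = t powr p" if "0 \<le> t" for t :: real
    using that by (metis powr_mult_base add_diff_cancel_left' add.commute diff_add_cancel)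
  let ?g = "\<lambda>x y. \<bar>x - y\<bar> * (p * even_powr (p - 1) x + p * even_powr (p - 1) y) / 2"
  have pos: "\<bar>odd_powr p x - odd_powr p y\<bar> \<le> ?g x y" if "0 \<le> y" "y \<le> x" for x y
  proof -
    have "x powr p - y powr p \<le> (x - y) * (p * x powr (p - 1) + p * y powr (p - 1)) / 2"
    proof (cases "y = 0")
      case True
      have "x powr p = x * x powr (p - 1)" using that mult[of x] by simp
      also have "\<dots> \<le> (p / 2) * (x * x powr (p - 1))"
        using mult_right_mono[of 1 "p / 2" "x * x powr (p - 1)"] p that by simp
      finally show ?thesis using True p by (simp add: mult_ac)
    next
      case False
      then show ?thesis using that p by (intro convex_powr_trapezoid) auto
    qed
    moreover have "y powr p \<le> x powr p" using that p by (intro powr_mono2) auto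
    ultimately show ?thesis
      using that p by (auto simp: odd_powr_def even_powr_def sgn_if)
  qed
  have opp: "\<bar>odd_powr p x - odd_powr p y\<bar> \<le> ?g x y" if "y \<le> 0" "0 \<le> x" for x y
  proof -
    let ?a = "x" and ?b = "- y"
    have "\<bar>odd_powr p x - odd_powr p y\<bar> = ?a powr p + ?b powr p"
      using that by (auto simp: odd_powr_def sgn_if)
    also have "\<dots> = ?a * ?a powr (p - 1) + ?b * ?b powr (p - 1)"
      using that mult[of ?a] mult[of ?b] by simp
    also have "\<dots> \<le> (?a + ?b) * ?a powr (p - 1) + (?a + ?b) * ?b powr (p - 1)"
      using that by (intro add_mono mult_right_mono) auto
    also have "\<dots> \<le> (p / 2) * ((?a + ?b) * ?a powr (p - 1) + (?a + ?b) * ?b powr (p - 1))"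
      using mult_right_mono[of 1 "p / 2" "(?a + ?b) * ?a powr (p - 1) + (?a + ?b) * ?b powr (p - 1)"] p that
      by simp
    also have "\<dots> = ?g x y"
      using that p by (simp add: even_powr_def field_simps)
    finally show ?thesis .
  qed
  have odd: "odd_powr p (- x) = - odd_powr p x" "even_powr (p - 1) (- x) = even_powr (p - 1) x" for x
    by (simp_all add: odd_powr_def even_powr_def sgn_minus)
  have neg: "\<bar>odd_powr p x - odd_powr p y\<bar> \<le> ?g x y" if "x \<le> 0" "y \<le> x" for x y
    using pos[of "- x" "- y"] that by (simp add: odd abs_minus_commute add.commute)
  have le: "\<bar>odd_powr p x - odd_powr p y\<bar> \<le> ?g x y" if "y \<le> x" for x y
    using pos opp neg that by (metis linear)
  show ?thesis
    using le[of x y] le[of y x] by (cases "y \<le> x") (auto simp: abs_minus_commute add.commute)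
qed

lemma even_powr_young:
  assumes q: "1 \<le> q" and x: "0 \<le> x"
  shows "x * even_powr (2 * q - 2) u \<le> x powr q / q + (q - 1) / q * \<bar>u\<bar> powr (2 * q)"
proof (cases "q = 1")
  case True
  then show ?thesis using x by (simp add: even_powr_def)
next
  case False
  with q have q: "1 < q" by simp
  then have "x * \<bar>u\<bar> powr (2 * q - 2) \<le> x powr q / q + (\<bar>u\<bar> powr (2 * q - 2)) powr (q / (q - 1)) / (q / (q - 1))"
    using x by (intro Youngs_inequality) (auto simp: field_simps)
  also have "(\<bar>u\<bar> powr (2 * q - 2)) powr (q / (q - 1)) = \<bar>u\<bar> powr (2 * q)"
  proof -
    have "(2 * q - 2) * (q / (q - 1)) = 2 * q" using q by (simp add: field_simps)
    then show ?thesis by (simp add: powr_powr)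
  qed
  finally show ?thesis using q by (simp add: even_powr_def field_simps)
qed

section \<open>Moment bounds\<close>

context product_matrix_function
begin

text \<open>The moment of the truncated eigenvalues appears on both sides with different weights, and it is
  finite because of the truncation, so it can be absorbed. The constant \<open>K = 2(2q-1)\<close>
  enters Young's inequality with the variance, which leaves exactly \<open>K^q\<close> after the
  absorption.\<close>

lemma truncated_moment_bound:
  assumes q: "q = 1 \<or> 3/2 \<le> q" and T: "0 \<le> T" and G: "0 \<le> G"
    and centered: "(\<integral>z. f z \<partial>P) = 0"
    and variance: "(\<integral>\<^sup>+z. ennreal (Re (trace (matrix_fun (\<lambda>t. max 0 t powr q) (variance z)))) \<partial>P) \<le> ennreal G"
  shows "(\<integral>\<^sup>+z. ennreal (Re (trace (matrix_fun (\<lambda>t. \<bar>clip T t\<bar> powr (2 * q)) (f z)))) \<partial>P)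
    \<le> ennreal ((2 * (2 * q - 1)) powr q * G)"
proof -
  have q1: "1 \<le> q" using q by auto
  define p where "p = 2 * q - 1"
  define K where "K = 2 * p"
  have p: "p = 1 \<or> 2 \<le> p" "1 \<le> p" using q by (auto simp: p_def)
  have p1: "p - 1 = 2 * q - 2" by (simp add: p_def)
  have K: "0 < K" using p by (simp add: K_def)
  define \<phi> where "\<phi> x = odd_powr p (clip T x)" for x
  define \<psi> where "\<psi> x = p * even_powr (p - 1) (clip T x)" for x
  define \<rho> where "\<rho> x = \<bar>clip T x\<bar> powr (2 * q)" for x
  have cont: "continuous_on UNIV \<phi>" "continuous_on UNIV \<psi>" "continuous_on UNIV \<rho>"
    unfolding \<phi>_def[abs_def] \<psi>_def[abs_def] \<rho>_def[abs_def] using p q1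
    by (auto intro!: continuous_intros continuous_on_powr' continuous_on_compose2[OF continuous_odd_powr]
        continuous_on_compose2[OF continuous_even_powr] continuous_clip)
  have \<rho>: "0 \<le> \<rho> x" "\<rho> x \<le> T powr (2 * q)" for x
    using abs_clip_le(1)[OF T] q1 by (auto simp: \<rho>_def intro!: powr_mono2)
  interpret mean_value_pair I M f \<phi> \<psi> "max (T powr p) (p * even_powr (p - 1) T)"
  proof
    show "continuous_on UNIV \<phi>" "continuous_on UNIV \<psi>" by (fact cont)+
    show "\<bar>\<phi> x\<bar> \<le> max (T powr p) (p * even_powr (p - 1) T)" for x
    proof -
      have "\<bar>\<phi> x\<bar> \<le> \<bar>clip T x\<bar> powr p"
        by (simp add: \<phi>_def odd_powr_def abs_mult sgn_if)
      also have "\<dots> \<le> T powr p" using abs_clip_le(1)[OF T] p by (intro powr_mono2) auto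
      finally show ?thesis by simp
    qed
    show "0 \<le> \<psi> x" for x using p by (simp add: \<psi>_def even_powr_nonneg)
    then have "\<bar>\<psi> x\<bar> = \<psi> x" for x by simp
    moreover have "\<psi> x \<le> p * even_powr (p - 1) T" for x
      unfolding \<psi>_def using p abs_clip_le(1)[OF T] by (intro mult_left_mono even_powr_mono) auto
    ultimately show "\<bar>\<psi> x\<bar> \<le> max (T powr p) (p * even_powr (p - 1) T)" for x
      by (simp add: le_max_iff_disj)
    show "\<bar>\<phi> x - \<phi> y\<bar> \<le> \<bar>x - y\<bar> * (\<psi> x + \<psi> y) / 2" for x y
    proof -
      have "\<bar>\<phi> x - \<phi> y\<bar> \<le> \<bar>clip T x - clip T y\<bar> * (\<psi> x + \<psi> y) / 2"
        unfolding \<phi>_def \<psi>_def by (rule odd_powr_trapezoid[OF p(1)])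
      also have "\<dots> \<le> \<bar>x - y\<bar> * (\<psi> x + \<psi> y) / 2"
        using p by (intro divide_right_mono mult_right_mono clip_lipschitz)
          (auto simp: \<psi>_def even_powr_nonneg intro!: add_nonneg_nonneg)
      finally show ?thesis .
    qed
  qed
  let ?tr = "\<lambda>\<phi> A. Re (trace (matrix_fun \<phi> A))"
  have \<rho>_meas [measurable]: "(\<lambda>z. matrix_fun \<rho> (f z)) \<in> borel_measurable P"
    by (rule borel_measurable_matrix_fun[OF cont(3) f_measurable herm])
  have v_meas [measurable]: "(\<lambda>z. matrix_fun (\<lambda>t. max 0 t powr q) (variance z)) \<in> borel_measurable P"
    using q1 by (intro borel_measurable_matrix_fun continuous_on_powr' continuous_intros hermitian_variance) auto
  have \<rho>_nonneg: "0 \<le> ?tr \<rho> (f z)" if "z \<in> space P" for z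
    by (rule trace_matrix_fun_nonneg[OF herm[OF that] \<rho>(1)])
  have "integrable P (\<lambda>z. ?tr \<rho> (f z))"
  proof (rule P.integrable_const_bound[where B = "real CARD('d) * T powr (2 * q)"])
    show "AE z in P. norm (?tr \<rho> (f z)) \<le> real CARD('d) * T powr (2 * q)"
    proof (rule AE_I2)
      fix z assume z: "z \<in> space P"
      have "?tr \<rho> (f z) \<le> ?tr (\<lambda>_. T powr (2 * q)) (f z)"
        by (rule trace_matrix_fun_mono[OF herm[OF z] \<rho>(2)])
      also have "\<dots> = real CARD('d) * T powr (2 * q)"
        unfolding matrix_fun_const[OF herm[OF z]] by (simp add: trace_def mat_def)
      finally show "norm (?tr \<rho> (f z)) \<le> real CARD('d) * T powr (2 * q)"
        using \<rho>_nonneg[OF z] by simp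
    qed
  qed measurable
  define F where "F = (\<integral>z. ?tr \<rho> (f z) \<partial>P)"
  have F_eq: "(\<integral>\<^sup>+z. ennreal (?tr \<rho> (f z)) \<partial>P) = ennreal F"
    unfolding F_def using \<open>integrable P _\<close> \<rho>_nonneg by (intro nn_integral_eq_integral AE_I2)
  have F: "0 \<le> F"
    unfolding F_def by (intro integral_nonneg_AE AE_I2 \<rho>_nonneg)
  define B where "B = (K powr q / q * G + (q - 1) / q * F) / 2"
  have B: "0 \<le> B" using G F q1 by (simp add: B_def)
  have "(\<integral>z. f z \<bullet> matrix_fun \<phi> (f z) \<partial>P) \<le> 2 * B"
  proof (rule correlation_le_of_local_variance[OF B centered])
    fix J
    have pointwise: "AE z in P. \<forall>Z\<in>space P. (\<Sum>i\<in>I. local_variance i z) \<bullet> matrix_fun \<psi> (f (mix J (z, Z)))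
      \<le> K powr q / q * ?tr (\<lambda>t. max 0 t powr q) (variance z) + (q - 1) / q * ?tr \<rho> (f (mix J (z, Z)))"
      using AE_variance_psd AE_space
    proof eventually_elim
      case (elim z)
      show ?case
      proof
        fix Z assume "Z \<in> space P"
        then have h: "hermitian (f (mix J (z, Z)))"
          using elim by (intro herm_mix) (simp add: space_pair_measure)
        (* The local variances sum to twice the variance, which turns \<psi> into K * even_powr. *)
        let ?k = "\<lambda>x. K * even_powr (p - 1) (clip T x)"
        have k: "matrix_fun ?k (f (mix J (z, Z))) = 2 *\<^sub>R matrix_fun \<psi> (f (mix J (z, Z)))"
          using matrix_fun_scaleR[OF h, of 2 \<psi>] by (simp add: \<psi>_def K_def mult.assoc)
        have "(\<Sum>i\<in>I. local_variance i z) \<bullet> matrix_fun \<psi> (f (mix J (z, Z)))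
            = Re (trace (variance z ** matrix_fun ?k (f (mix J (z, Z)))))"
          unfolding k using elim
          by (simp add: Re_trace_mult_eq_inner hermitian_variance) (simp add: variance_def)
        also have "\<dots> \<le> ?tr (\<lambda>t. K powr q / q * max 0 t powr q) (variance z)
            + ?tr (\<lambda>x. (q - 1) / q * \<rho> x) (f (mix J (z, Z)))"
        proof (rule trace_psd_matrix_fun_mult_le)
          fix x y :: real assume "0 \<le> x"
          then show "x * ?k y \<le> K powr q / q * max 0 x powr q + (q - 1) / q * \<rho> y"
            using even_powr_young[OF q1, of "K * x" "clip T y"] K
            by (simp add: p1 \<rho>_def powr_mult mult_ac)
        qed (use elim h hermitian_variance in auto)
        also have "\<dots> = K powr q / q * ?tr (\<lambda>t. max 0 t powr q) (variance z) + (q - 1) / q * ?tr \<rho> (f (mix J (z, Z)))"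
        proof -
          have "Re (trace (c *\<^sub>R X)) = c * Re (trace X)" for c and X :: "complex^'d^'d"
            by (simp add: trace_def sum_distrib_left)
          then show ?thesis
            using elim h by (simp only: matrix_fun_scaleR hermitian_variance)
        qed
        finally show "(\<Sum>i\<in>I. local_variance i z) \<bullet> matrix_fun \<psi> (f (mix J (z, Z)))
          \<le> K powr q / q * ?tr (\<lambda>t. max 0 t powr q) (variance z) + (q - 1) / q * ?tr \<rho> (f (mix J (z, Z)))" .
      qed
    qed
    let ?a = "ennreal (K powr q / q)" and ?b = "ennreal ((q - 1) / q)"
    have "(\<integral>\<^sup>+z. \<integral>\<^sup>+Z. ennreal ((\<Sum>i\<in>I. local_variance i z) \<bullet> matrix_fun \<psi> (f (mix J (z, Z)))) \<partial>P \<partial>P)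
      \<le> (\<integral>\<^sup>+z. \<integral>\<^sup>+Z. ?a * ennreal (?tr (\<lambda>t. max 0 t powr q) (variance (fst (z, Z))))
        + ?b * ennreal (?tr \<rho> (f (mix J (z, Z)))) \<partial>P \<partial>P)"
    proof (rule nn_integral_mono_AE)
      show "AE z in P. (\<integral>\<^sup>+Z. ennreal ((\<Sum>i\<in>I. local_variance i z) \<bullet> matrix_fun \<psi> (f (mix J (z, Z)))) \<partial>P)
        \<le> (\<integral>\<^sup>+Z. ?a * ennreal (?tr (\<lambda>t. max 0 t powr q) (variance (fst (z, Z))))
        + ?b * ennreal (?tr \<rho> (f (mix J (z, Z)))) \<partial>P)"
        using pointwise AE_space
      proof eventually_elim
        case (elim z)
        show ?case
        proof (rule nn_integral_mono)
          fix Z assume Z: "Z \<in> space P"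
          have nn: "0 \<le> ?tr (\<lambda>t. max 0 t powr q) (variance z)" "0 \<le> ?tr \<rho> (f (mix J (z, Z)))"
            using elim Z by (auto intro!: trace_matrix_fun_nonneg \<rho> hermitian_variance herm_mix simp: space_pair_measure)
          show "ennreal ((\<Sum>i\<in>I. local_variance i z) \<bullet> matrix_fun \<psi> (f (mix J (z, Z))))
            \<le> ?a * ennreal (?tr (\<lambda>t. max 0 t powr q) (variance (fst (z, Z)))) + ?b * ennreal (?tr \<rho> (f (mix J (z, Z))))"
            using elim Z nn q1 by (simp add: ennreal_mult[symmetric] ennreal_plus[symmetric] ennreal_leI del: ennreal_plus)
        qed
      qed
    qed
    also have "\<dots> = (\<integral>\<^sup>+w. ?a * ennreal (?tr (\<lambda>t. max 0 t powr q) (variance (mix {} w)))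
        + ?b * ennreal (?tr \<rho> (f (mix J w))) \<partial>PP)"
      unfolding mix_empty by (rule P.nn_integral_fst) measurable
    also have "\<dots> = ?a * (\<integral>\<^sup>+w. ennreal (?tr (\<lambda>t. max 0 t powr q) (variance (mix {} w))) \<partial>PP)
        + ?b * (\<integral>\<^sup>+w. ennreal (?tr \<rho> (f (mix J w))) \<partial>PP)"
      by (simp add: nn_integral_add nn_integral_cmult)
    also have "(\<integral>\<^sup>+w. ennreal (?tr (\<lambda>t. max 0 t powr q) (variance (mix {} w))) \<partial>PP)
        = (\<integral>\<^sup>+z. ennreal (?tr (\<lambda>t. max 0 t powr q) (variance z)) \<partial>P)"
      by (rule nn_integral_mix) measurable
    also have "(\<integral>\<^sup>+w. ennreal (?tr \<rho> (f (mix J w))) \<partial>PP) = ennreal F"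
      unfolding F_eq[symmetric] by (rule nn_integral_mix) measurable
    also have "?a * (\<integral>\<^sup>+z. ennreal (?tr (\<lambda>t. max 0 t powr q) (variance z)) \<partial>P) + ?b * ennreal F
        \<le> ?a * ennreal G + ?b * ennreal F"
      by (intro add_mono mult_left_mono variance order_refl) simp
    also have "\<dots> = ennreal (2 * B)"
    proof -
      have "2 * (x / 2) = x" for x :: real by simp
      then have "2 * B = K powr q / q * G + (q - 1) / q * F" unfolding B_def .
      then show ?thesis
        using q1 G F by (simp only:) (simp add: ennreal_mult[symmetric] ennreal_plus[symmetric] del: ennreal_plus)
    qed
    finally show "(\<integral>\<^sup>+z. \<integral>\<^sup>+Z. ennreal ((\<Sum>i\<in>I. local_variance i z) \<bullet> matrix_fun \<psi> (f (mix J (z, Z)))) \<partial>P \<partial>P)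
      \<le> ennreal (2 * B)" .
  qed
  moreover have "F \<le> (\<integral>z. f z \<bullet> matrix_fun \<phi> (f z) \<partial>P)"
    unfolding F_def
  proof (rule integral_mono)
    have "integrable PP (\<lambda>w. f (mix {} w) \<bullet> matrix_fun \<phi> (f (mix {} w)))"
      by (rule integrable_correlation)
    moreover have "(\<lambda>z. matrix_fun \<phi> (f z)) \<in> borel_measurable P"
      by (rule borel_measurable_matrix_fun[OF cont(1) f_measurable herm])
    ultimately show "integrable P (\<lambda>z. f z \<bullet> matrix_fun \<phi> (f z))"
      using integrable_distr_eq[OF measurable_mix, of "\<lambda>z. f z \<bullet> matrix_fun \<phi> (f z)" "{}"] by (simp add: distr_mix)
  next
    fix z assume z: "z \<in> space P"
    have "?tr \<rho> (f z) \<le> ?tr (\<lambda>x. x * \<phi> x) (f z)"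
    proof (rule trace_matrix_fun_mono[OF herm[OF z]])
      fix x
      have "2 * q = 1 + p" by (simp add: p_def)
      then have "\<rho> x = \<bar>clip T x\<bar> * \<bar>clip T x\<bar> powr p"
        unfolding \<rho>_def by (simp add: powr_mult_base)
      also have "\<dots> \<le> \<bar>x\<bar> * \<bar>clip T x\<bar> powr p"
        by (intro mult_right_mono abs_clip_le T) simp
      also have "\<dots> = x * \<phi> x"
      proof (cases "clip T x = 0")
        case False
        then have "sgn (clip T x) = sgn x" using T by (auto simp: clip_def sgn_if max_def min_def split: if_splits)
        then show ?thesis by (simp add: \<phi>_def odd_powr_def abs_sgn)
      qed (use p in \<open>simp add: \<phi>_def odd_powr_def\<close>)
      finally show "\<rho> x \<le> x * \<phi> x" .
    qed
    also have "\<dots> = f z \<bullet> matrix_fun \<phi> (f z)"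
      using matrix_fun_mult[OF herm[OF z], of "\<lambda>x. x" \<phi>] matrix_fun_id[OF herm[OF z]]
      by (simp add: Re_trace_mult_eq_inner[OF herm[OF z]])
    finally show "?tr \<rho> (f z) \<le> f z \<bullet> matrix_fun \<phi> (f z)" .
  qed fact
  ultimately have "F \<le> K powr q / q * G + (q - 1) / q * F"
    by (simp add: B_def)
  then have "F \<le> K powr q * G"
    using q1 by (simp add: field_simps)
  then show ?thesis
    using F_eq unfolding \<rho>_def K_def p_def by (simp add: ennreal_leI)
qed

lemma moment_bound:
  assumes q: "q = 1 \<or> 3/2 \<le> q" and G: "0 \<le> G"
    and centered: "(\<integral>z. f z \<partial>P) = 0"
    and variance: "(\<integral>\<^sup>+z. ennreal (Re (trace (matrix_fun (\<lambda>t. max 0 t powr q) (variance z)))) \<partial>P) \<le> ennreal G"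
  shows "(\<integral>\<^sup>+z. ennreal (Re (trace (matrix_fun (\<lambda>t. \<bar>t\<bar> powr (2 * q)) (f z)))) \<partial>P)
    \<le> ennreal ((2 * (2 * q - 1)) powr q * G)"
proof -
  let ?h = "\<lambda>k z. ennreal (Re (trace (matrix_fun (\<lambda>t. \<bar>clip (real k) t\<bar> powr (2 * q)) (f z))))"
  have meas [measurable]: "?h k \<in> borel_measurable P" for k
  proof -
    have "continuous_on UNIV (\<lambda>t. \<bar>clip (real k) t\<bar> powr (2 * q))"
      using q by (auto intro!: continuous_on_powr' continuous_on_rabs continuous_clip continuous_on_const)
    from borel_measurable_matrix_fun[OF this f_measurable herm] show ?thesis by measurable
  qed
  have lim: "(\<lambda>k. ?h k z) \<longlonglongrightarrow> ennreal (Re (trace (matrix_fun (\<lambda>t. \<bar>t\<bar> powr (2 * q)) (f z))))"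
    if z: "z \<in> space P" for z
  proof -
    obtain U l where U: "\<And>\<phi>. matrix_fun \<phi> (f z) = diag_in U (\<lambda>i. \<phi> (l i))"
      using matrix_fun_cases[OF herm[OF z]] by metis
    obtain N where N: "(\<Sum>i\<in>UNIV. \<bar>l i\<bar>) \<le> real N" using real_arch_simple by blast
    have "\<bar>l i\<bar> \<le> real N" for i
      using member_le_sum[of i UNIV "\<lambda>i. \<bar>l i\<bar>"] N by simp
    (* Once k exceeds all eigenvalues in modulus, the truncation has no effect. *)
    then have "?h k z = ennreal (Re (trace (matrix_fun (\<lambda>t. \<bar>t\<bar> powr (2 * q)) (f z))))" if "N \<le> k" for k
      using that by (simp add: U clip_eq order_trans[of _ "real N" "real k"])
    then show ?thesis
      by (intro tendsto_eventually eventually_sequentiallyI[of N])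
  qed
  have "(\<integral>\<^sup>+z. ennreal (Re (trace (matrix_fun (\<lambda>t. \<bar>t\<bar> powr (2 * q)) (f z)))) \<partial>P) = (\<integral>\<^sup>+z. liminf (\<lambda>k. ?h k z) \<partial>P)"
    by (intro nn_integral_cong) (simp add: lim_imp_Liminf[OF _ lim])
  also have "\<dots> \<le> liminf (\<lambda>k. \<integral>\<^sup>+z. ?h k z \<partial>P)"
    by (intro nn_integral_liminf meas)
  also have "\<dots> \<le> liminf (\<lambda>k. ennreal ((2 * (2 * q - 1)) powr q * G))"
    by (intro Liminf_mono always_eventually allI truncated_moment_bound q G centered variance) simp
  finally show ?thesis by (simp only: Liminf_const[OF trivial_limit_sequentially])
qed

end

text \<open>Only a finite \<open>g\<close> has to be considered, as the right side is infinite otherwise.\<close>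

lemma ennreal_powr_root_le:
  assumes q: "0 < q" and K: "0 < K" and le: "\<And>G. 0 \<le> G \<Longrightarrow> g = ennreal G \<Longrightarrow> l \<le> ennreal (K powr q * G)"
  shows "ennreal_powr l (1 / (2 * q)) \<le> ennreal (sqrt K) * ennreal_powr g (1 / (2 * q))"
proof (cases g)
  case top
  then show ?thesis using K by (simp add: ennreal_powr_def ennreal_mult_top)
next
  case (real G)
  from le[OF this] have l: "l \<le> ennreal (K powr q * G)" .
  then have "l < \<infinity>" by (rule order_le_less_trans) simp
  then obtain r where r: "0 \<le> r" "l = ennreal r" by (cases l) auto
  with l real K have "r \<le> K powr q * G" by (simp add: ennreal_le_iff)
  then have "r powr (1 / (2 * q)) \<le> (K powr q * G) powr (1 / (2 * q))"
    using r q by (intro powr_mono2) auto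
  also have "\<dots> = sqrt K * G powr (1 / (2 * q))"
    using K q real by (simp add: powr_mult powr_powr powr_half_sqrt)
  finally show ?thesis
    using r real K by (simp add: ennreal_powr_def ennreal_mult[symmetric] ennreal_leI)
qed

theorem corollary3p3:
  fixes n :: nat
    and T :: "nat \<Rightarrow> 'a topology"
    and M :: "nat \<Rightarrow> 'a measure"
    and \<mu> :: "(nat \<Rightarrow> 'a) measure"
    and f :: "(nat \<Rightarrow> 'a) \<Rightarrow> complex^'d^'d"
    and q :: real
  assumes "\<And>i. i \<in> {1..n} \<Longrightarrow> polish_topology (T i)"
    and "\<And>i. i \<in> {1..n} \<Longrightarrow> sets (M i) = sets (borel_of_topology (T i))"
    and "\<And>i. i \<in> {1..n} \<Longrightarrow> prob_space (M i)"
    and "\<mu> = Pi\<^sub>M {1..n} M"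
    and "suitable \<mu> f"
    and "q = 1 \<or> q \<ge> 3/2"
  shows "ennreal_powr
      (expected_trace \<mu> (\<lambda>z. matrix_fun (\<lambda>t. \<bar>t\<bar> powr (2*q)) (f z - matrix_expectation \<mu> f)))
      (1 / (2*q))
    \<le> ennreal (sqrt (2 * (2*q - 1))) *
      ennreal_powr
        (expected_trace \<mu> (\<lambda>z. matrix_fun (\<lambda>t. t powr q) (variance_proxy n \<mu> f z)))
        (1 / (2*q))"
proof -
  (* Outside the index set the factors are arbitrary; point masses make all of them probability
     spaces without changing the product. *)
  define N where "N i = (if i \<in> {1..n} then M i else return (count_space UNIV) undefined)" for i
  have prob_N: "prob_space (N i)" for i
    using assms(3) by (simp add: N_def prob_space_return)
  have \<mu>: "\<mu> = PiM {1..n} N"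
    unfolding assms(4) by (rule PiM_cong) (simp_all add: N_def)
  have f [measurable]: "f \<in> borel_measurable \<mu>" and herm: "\<And>z. z \<in> space \<mu> \<Longrightarrow> hermitian (f z)"
    using assms(5) by (auto simp: suitable_def)
  interpret F: product_matrix_function "{1..n}" N f
    using f herm suitable_imp_square_integrable[OF assms(5)] prob_N
    unfolding \<mu> product_matrix_function_def by blast
  define m where "m = matrix_expectation \<mu> f"
  have m: "m = (\<integral>z. f z \<partial>\<mu>)"
    using F.integrable_f unfolding m_def \<mu> by (rule matrix_expectation_eq_integral)
  have herm_m: "hermitian m"
  proof -
    have cnj: "cnj (f z $ j $ k) = f z $ k $ j" if "z \<in> space \<mu>" for z j k
      using herm[OF that] by (metis conj_transpose_nth hermitian_def)
    have "cnj (m $ j $ k) = m $ k $ j" for j k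
      unfolding m_def matrix_expectation_def vec_lambda_beta Bochner_Integration.integral_cnj[symmetric]
      by (rule Bochner_Integration.integral_cong[OF refl cnj])
    then show ?thesis by (simp add: hermitian_def vec_eq_iff)
  qed
  interpret H: product_matrix_function "{1..n}" N "\<lambda>z. f z - m"
  proof (rule product_matrix_function.intro)
    show "(\<lambda>z. f z - m) \<in> borel_measurable (PiM {1..n} N)" by measurable
    show "hermitian (f z - m)" if "z \<in> space (PiM {1..n} N)" for z
      using that by (intro hermitian_diff F.herm herm_m)
    show "integrable (PiM {1..n} N) (\<lambda>z. (norm (f z - m))\<^sup>2)"
    proof (rule Bochner_Integration.integrable_bound)
      show "integrable (PiM {1..n} N) (\<lambda>z. 2 * (norm (f z))\<^sup>2 + 2 * (norm m)\<^sup>2)"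
        by (intro Bochner_Integration.integrable_add integrable_mult_right F.square_integrable F.P.integrable_const)
      have "(norm (f z - m))\<^sup>2 \<le> 2 * (norm (f z))\<^sup>2 + 2 * (norm m)\<^sup>2" for z
      proof -
        have "(norm (f z - m))\<^sup>2 \<le> (norm (f z) + norm m)\<^sup>2"
          by (intro power_mono norm_triangle_ineq4) simp
        also have "\<dots> \<le> 2 * (norm (f z))\<^sup>2 + 2 * (norm m)\<^sup>2"
          using sum_squares_bound[of "norm (f z)" "norm m"] by (simp add: power2_sum)
        finally show ?thesis .
      qed
      then show "AE z in PiM {1..n} N. norm ((norm (f z - m))\<^sup>2) \<le> norm (2 * (norm (f z))\<^sup>2 + 2 * (norm m)\<^sup>2)"
        by simp
    qed measurable
  qed (rule finite_atLeastAtMost, rule prob_N)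
  have proxy: "variance_proxy n \<mu> f z = H.variance z" for z
    unfolding variance_proxy_def H.variance_def H.local_variance_def \<mu> by simp
  have centered: "(\<integral>z. f z - m \<partial>PiM {1..n} N) = 0"
    using m[symmetric] unfolding \<mu>
    by (subst Bochner_Integration.integral_diff[OF F.integrable_f F.P.integrable_const])
      (simp only: lebesgue_integral_const F.P.prob_space scaleR_one diff_self)
  show ?thesis
  proof (rule ennreal_powr_root_le)
    fix G assume G: "0 \<le> G"
      and eq: "expected_trace \<mu> (\<lambda>z. matrix_fun (\<lambda>t. t powr q) (variance_proxy n \<mu> f z)) = ennreal G"
    have "(\<integral>\<^sup>+z. ennreal (Re (trace (matrix_fun (\<lambda>t. max 0 t powr q) (H.variance z)))) \<partial>PiM {1..n} N) \<le> ennreal G"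
      using eq unfolding expected_trace_def proxy unfolding \<mu> H.nn_integral_variance_powr by simp
    from H.moment_bound[OF assms(6) G centered this]
    show "expected_trace \<mu> (\<lambda>z. matrix_fun (\<lambda>t. \<bar>t\<bar> powr (2*q)) (f z - matrix_expectation \<mu> f))
      \<le> ennreal ((2 * (2*q - 1)) powr q * G)"
      unfolding expected_trace_def m_def[symmetric] unfolding \<mu> .
  qed (use assms(6) in auto)
qed

end
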